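(* Substitute $q=e^h=\sum_{n\ge0}h^n/n!$ in the star product $\star$ on $\mathbb{C}_q[t_{41},t_{42},t_{31},t_{32}]$ defined in the context, and expand in powers of $h$: for $f,g\in\mathbb{C}[t_{41},t_{42},t_{31},t_{32}]$ write $$f\star g=fg+\sum_{j=1}^\infty h^j C_j(f,g),\qquad C_j(f,g)\in\mathbb{C}[t_{41},t_{42},t_{31},t_{32}].$$ Then for every $j\ge 1$ there is a bidifferential operator $B_j$ such that $C_j(f,g)=B_j(f,g)$ for all $f,g\in\mathbb{C}[t_{41},t_{42},t_{31},t_{32}]$.
   Context: Let $\mathbb{C}_q=\mathbb{C}[q,q^{-1}]$. The quantum Minkowski space $\mathcal{O}_q(\mathrm{M})$ is the associative unital $\mathbb{C}_q$-algebra generated by $\hat t_{41},\hat t_{42},\hat t_{31},\hat t_{32}$ subject to the relations $$\hat t_{42}\hat t_{41}=q^{-1}\hat t_{41}\hat t_{42},\quad \hat t_{31}\hat t_{41}=q^{-1}\hat t_{41}\hat t_{31},\quad \hat t_{32}\hat t_{41}=\hat t_{41}\hat t_{32}+(q^{-1}-q)\hat t_{42}\hat t_{31},$$ $$\hat t_{31}\hat t_{42}=\hat t_{42}\hat t_{31},\quad \hat t_{32}\hat t_{42}=q^{-1}\hat t_{42}\hat t_{32},\quad \hat t_{32}\hat t_{31}=q^{-1}\hat t_{31}\hat t_{32}.$$ It is known that the $\mathbb{C}_q$-linear map $$Q:\mathbb{C}_q[t_{41},t_{42},t_{31},t_{32}]\to\mathcal{O}_q(\mathrm{M}),\qquad t_{41}^a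 t_{42}^b t_{31}^c t_{32}^d\mapsto \hat t_{41}^a\hat t_{42}^b\hat t_{31}^c\hat t_{32}^d,$$ from the commutative polynomial ring is an isomorphism of $\mathbb{C}_q$-modules. The star product is $f\star g=Q^{-1}(Q(f)Q(g))$. For $f,g$ polynomials with coefficients in $\mathbb{C}$, the coefficients of $f\star g$ are Laurent polynomials in $q$, which become formal power series in $h$ upon setting $q=e^h$. A bidifferential operator here means an operator of the form $B(f,g)=\sum_{\alpha,\beta}b_{\alpha\beta}\,(\partial^\alpha f)(\partial^\beta g)$, a finite sum over multi-indices $\alpha,\beta\in\mathbb{N}^4$, where $\partial^\alpha$ are partial derivatives in the variables $t_{41},t_{42},t_{31},t_{32}$ and the coefficients $b_{\alpha\beta}\in\mathbb{C}[t_{41},t_{42},t_{31},t_{32}]$ are fixed polynomials (independent of $f$ and $g$). *)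

theory Defs
  imports
    Complex_Main
    "HOL-Library.Poly_Mapping"
    "HOL-Computational_Algebra.Formal_Power_Series"
begin

datatype gen = T41 | T42 | T31 | T32

text \<open>
  The ring \<open>\<complex>[q, q\<inverse>]\<close> is the group algebra of \<open>\<int>\<close>: the key \<open>k\<close> stands for \<open>q\<^sup>k\<close>.
  Likewise the key \<open>m\<close> of an element of \<open>'a mpoly\<close> stands for the monomial with exponents \<open>lookup m\<close>.
\<close>

type_synonym laurent = "int \<Rightarrow>\<^sub>0 complex"

type_synonym 'a mpoly = "(gen \<Rightarrow>\<^sub>0 nat) \<Rightarrow>\<^sub>0 'a"

definition qpow :: "int \<Rightarrow> laurent" where
  "qpow k = Poly_Mapping.single k 1"

text \<open>
  Words in the generators form the free monoid (written additively, because the keys of a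
  \<open>poly_mapping\<close> are multiplied by adding them), so \<open>free_alg\<close> is the free associative
  unital algebra over \<open>laurent\<close>.
\<close>

datatype word = Word (letters: "gen list")

instantiation word :: monoid_add
begin

definition zero_word :: word where
  "0 = Word []"

definition plus_word :: "word \<Rightarrow> word \<Rightarrow> word" where
  "u + v = Word (letters u @ letters v)"

instance
  by standard (simp_all add: zero_word_def plus_word_def)

end

type_synonym free_alg = "word \<Rightarrow>\<^sub>0 laurent"

definition fgen :: "gen \<Rightarrow> free_alg" where
  "fgen i = Poly_Mapping.single (Word [i]) 1"

definition fscalar :: "laurent \<Rightarrow> free_alg" where
  "fscalar c = Poly_Mapping.single 0 c"

definition relators :: "free_alg set" where
  "relators =
    {fgen T42 * fgen T41 - fscalar (qpow (-1)) * (fgen T41 * fgen T42),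
     fgen T31 * fgen T41 - fscalar (qpow (-1)) * (fgen T41 * fgen T31),
     fgen T32 * fgen T41 -
       (fgen T41 * fgen T32 + fscalar (qpow (-1) - qpow 1) * (fgen T42 * fgen T31)),
     fgen T31 * fgen T42 - fgen T42 * fgen T31,
     fgen T32 * fgen T42 - fscalar (qpow (-1)) * (fgen T42 * fgen T32),
     fgen T32 * fgen T31 - fscalar (qpow (-1)) * (fgen T31 * fgen T32)}"

inductive_set rel_ideal :: "free_alg set" where
  zero: "0 \<in> rel_ideal"
| gen: "r \<in> relators \<Longrightarrow> a * r * b \<in> rel_ideal"
| add: "x \<in> rel_ideal \<Longrightarrow> y \<in> rel_ideal \<Longrightarrow> x + y \<in> rel_ideal"

lemma rel_ideal_mult_left: "x \<in> rel_ideal \<Longrightarrow> c * x \<in> rel_ideal"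
proof (induction rule: rel_ideal.induct)
  case (gen r a b)
  then show ?case
    using rel_ideal.gen[of r "c * a" b] by (simp add: mult.assoc)
qed (auto simp: distrib_left intro: rel_ideal.intros)

lemma rel_ideal_mult_right: "x \<in> rel_ideal \<Longrightarrow> x * c \<in> rel_ideal"
proof (induction rule: rel_ideal.induct)
  case (gen r a b)
  then show ?case
    using rel_ideal.gen[of r a "b * c"] by (simp add: mult.assoc)
qed (auto simp: distrib_right intro: rel_ideal.intros)

lemma rel_ideal_uminus: "x \<in> rel_ideal \<Longrightarrow> - x \<in> rel_ideal"
  using rel_ideal_mult_left[of x "- 1"] by simp

lemma rel_ideal_diff: "x \<in> rel_ideal \<Longrightarrow> y \<in> rel_ideal \<Longrightarrow> x - y \<in> rel_ideal"
  using rel_ideal.add[of x "- y"] rel_ideal_uminus[of y] by simp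

lemma lookup_times_empty_word:
  fixes x y :: free_alg
  shows "Poly_Mapping.lookup (x * y) 0 = Poly_Mapping.lookup x 0 * Poly_Mapping.lookup y 0"
proof -
  have *: "(0 = u + v) \<longleftrightarrow> u = 0 \<and> v = 0" for u v :: word
    by (cases u; cases v) (auto simp: zero_word_def plus_word_def)
  have "Poly_Mapping.lookup (x * y) 0 =
      (\<Sum>u. Poly_Mapping.lookup x u * (\<Sum>v. (Poly_Mapping.lookup y v when (0::word) = u + v)))"
    by (simp add: lookup_mult)
  also have "\<dots> = (\<Sum>u. (Poly_Mapping.lookup x u * Poly_Mapping.lookup y 0 when u = 0))"
  proof (rule Sum_any.cong)
    fix u :: word
    show "Poly_Mapping.lookup x u * (\<Sum>v. (Poly_Mapping.lookup y v when (0::word) = u + v)) =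
        ((Poly_Mapping.lookup x u * Poly_Mapping.lookup y 0) when u = 0)"
      by (cases "u = 0") (simp_all add: *)
  qed
  finally show ?thesis
    by simp
qed

lemma lookup_relator_empty_word: "r \<in> relators \<Longrightarrow> Poly_Mapping.lookup r 0 = 0"
proof -
  have "Poly_Mapping.lookup (fgen i) 0 = 0" for i
    by (simp add: fgen_def lookup_single zero_word_def)
  then show "r \<in> relators \<Longrightarrow> Poly_Mapping.lookup r 0 = 0"
    by (auto simp only: relators_def insert_iff empty_iff lookup_minus lookup_add
      lookup_times_empty_word mult_zero_left mult_zero_right add_0 diff_0_right)
qed

lemma lookup_rel_ideal_empty_word: "x \<in> rel_ideal \<Longrightarrow> Poly_Mapping.lookup x 0 = 0"
  by (induction rule: rel_ideal.induct)
    (auto simp: lookup_add lookup_times_empty_word lookup_relator_empty_word)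

lemma one_notin_rel_ideal: "1 \<notin> rel_ideal"
  using lookup_rel_ideal_empty_word[of 1] by (auto simp: lookup_one)

definition rel_cong :: "free_alg \<Rightarrow> free_alg \<Rightarrow> bool" where
  "rel_cong x y \<longleftrightarrow> x - y \<in> rel_ideal"

quotient_type qmink = free_alg / rel_cong
proof (rule equivpI)
  show "reflp rel_cong"
    by (auto simp: reflp_def rel_cong_def intro: rel_ideal.zero)
  show "symp rel_cong"
    unfolding symp_def rel_cong_def by (metis minus_diff_eq rel_ideal_uminus)
  show "transp rel_cong"
  proof (rule transpI)
    fix x y z
    assume "rel_cong x y" "rel_cong y z"
    then show "rel_cong x z"
      using rel_ideal.add[of "x - y" "y - z"] by (simp add: rel_cong_def)
  qed
qed

instantiation qmink :: ring_1
begin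

lift_definition zero_qmink :: qmink is 0 .

lift_definition one_qmink :: qmink is 1 .

lift_definition plus_qmink :: "qmink \<Rightarrow> qmink \<Rightarrow> qmink" is "(+)"
  unfolding rel_cong_def by (simp only: add_diff_add rel_ideal.add)

lift_definition minus_qmink :: "qmink \<Rightarrow> qmink \<Rightarrow> qmink" is "(-)"
proof -
  fix x x' y y' :: free_alg
  assume "rel_cong x x'" "rel_cong y y'"
  moreover have "(x - y) - (x' - y') = (x - x') - (y - y')"
    by simp
  ultimately show "rel_cong (x - y) (x' - y')"
    unfolding rel_cong_def by (simp only: rel_ideal_diff)
qed

lift_definition uminus_qmink :: "qmink \<Rightarrow> qmink" is uminus
  unfolding rel_cong_def by (simp only: minus_diff_minus rel_ideal_uminus)

lift_definition times_qmink :: "qmink \<Rightarrow> qmink \<Rightarrow> qmink" is "(*)"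
proof -
  fix x x' y y' :: free_alg
  assume "rel_cong x x'" "rel_cong y y'"
  moreover have "x * y - x' * y' = (x - x') * y + x' * (y - y')"
    by (simp add: algebra_simps)
  ultimately show "rel_cong (x * y) (x' * y')"
    unfolding rel_cong_def
    by (simp only: rel_ideal.add rel_ideal_mult_left rel_ideal_mult_right)
qed

instance
proof
  fix a b c :: qmink
  show "a + b + c = a + (b + c)"
    by transfer (simp add: rel_cong_def add.assoc rel_ideal.zero)
  show "a + b = b + a"
    by transfer (simp add: rel_cong_def add.commute rel_ideal.zero)
  show "0 + a = a" "- a + a = 0" "a - b = a + - b" "1 * a = a" "a * 1 = a"
    by (transfer, simp add: rel_cong_def rel_ideal.zero)+
  show "a * b * c = a * (b * c)"
    by transfer (simp add: rel_cong_def mult.assoc rel_ideal.zero)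
  show "(a + b) * c = a * c + b * c"
    by transfer (simp add: rel_cong_def distrib_right rel_ideal.zero)
  show "a * (b + c) = a * b + a * c"
    by transfer (simp add: rel_cong_def distrib_left rel_ideal.zero)
  show "(0::qmink) \<noteq> 1"
    by transfer (use rel_ideal_uminus[of "- 1"] one_notin_rel_ideal in \<open>auto simp: rel_cong_def\<close>)
qed

end

lift_definition tgen :: "gen \<Rightarrow> qmink" is fgen .

lift_definition tscalar :: "laurent \<Rightarrow> qmink" is fscalar .

definition Q :: "laurent mpoly \<Rightarrow> qmink" where
  "Q f = (\<Sum>m\<in>Poly_Mapping.keys f. tscalar (Poly_Mapping.lookup f m) *
     (tgen T41 ^ Poly_Mapping.lookup m T41 * tgen T42 ^ Poly_Mapping.lookup m T42 *
      tgen T31 ^ Poly_Mapping.lookup m T31 * tgen T32 ^ Poly_Mapping.lookup m T32))"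

text \<open>\<open>Q\<close> is bijective (Poincare-Birkhoff-Witt), so \<open>inv Q\<close> is a genuine two-sided inverse.\<close>

definition star :: "laurent mpoly \<Rightarrow> laurent mpoly \<Rightarrow> laurent mpoly" where
  "star f g = inv Q (Q f * Q g)"

definition embed :: "complex mpoly \<Rightarrow> laurent mpoly" where
  "embed f = Poly_Mapping.map (\<lambda>c. Poly_Mapping.single 0 c) f"

text \<open>The substitution \<open>q = e\<^sup>h\<close>; \<open>fps_exp 1\<close> is the power series of \<open>e\<^sup>h\<close> in the variable \<open>h\<close>.\<close>

definition subst_exp :: "laurent \<Rightarrow> complex fps" where
  "subst_exp a = (\<Sum>k\<in>Poly_Mapping.keys a. fps_const (Poly_Mapping.lookup a k) * (fps_exp 1 powi k))"

text \<open>Substitution in every coefficient, regrouped as a power series in \<open>h\<close> with polynomial coefficients.\<close>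

definition h_expand :: "laurent mpoly \<Rightarrow> complex mpoly fps" where
  "h_expand F = Abs_fps (\<lambda>j. Poly_Mapping.map (\<lambda>a. fps_nth (subst_exp a) j) F)"

definition star_coeff :: "nat \<Rightarrow> complex mpoly \<Rightarrow> complex mpoly \<Rightarrow> complex mpoly" where
  "star_coeff j f g = fps_nth (h_expand (star (embed f) (embed g))) j"

definition pderiv_var :: "gen \<Rightarrow> complex mpoly \<Rightarrow> complex mpoly" where
  "pderiv_var i f = (\<Sum>m\<in>Poly_Mapping.keys f.
     Poly_Mapping.single (m - Poly_Mapping.single i 1)
       (of_nat (Poly_Mapping.lookup m i) * Poly_Mapping.lookup f m))"

definition pderiv_multi :: "(gen \<Rightarrow>\<^sub>0 nat) \<Rightarrow> complex mpoly \<Rightarrow> complex mpoly" where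
  "pderiv_multi \<alpha> f =
     (pderiv_var T41 ^^ Poly_Mapping.lookup \<alpha> T41) ((pderiv_var T42 ^^ Poly_Mapping.lookup \<alpha> T42)
       ((pderiv_var T31 ^^ Poly_Mapping.lookup \<alpha> T31) ((pderiv_var T32 ^^ Poly_Mapping.lookup \<alpha> T32) f)))"

definition bidifferential ::
    "(complex mpoly \<Rightarrow> complex mpoly \<Rightarrow> complex mpoly) \<Rightarrow> bool" where
  "bidifferential B \<longleftrightarrow>
     (\<exists>S b. finite S \<and>
        (\<forall>f g. B f g = (\<Sum>(\<alpha>, \<beta>)\<in>S. b \<alpha> \<beta> * pderiv_multi \<alpha> f * pderiv_multi \<beta> g)))"

end

theory Submission
  imports Defs
begin

text \<open>
  Left multiplication by the generators, written out on ordered monomials, defines an action of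
  \<open>qmink\<close> on polynomials with \<open>Q f\<close> sending \<open>1\<close> to \<open>f\<close>. Hence \<open>Q\<close> is injective and
  \<open>f \<star> g\<close> is the action of \<open>Q f\<close> on \<open>g\<close>. Reordering \<open>t\<^sub>3\<^sub>2\<^sup>r t\<^sub>4\<^sub>1\<^sup>s\<close> produces terms
  in which \<open>i\<close> pairs \<open>t\<^sub>4\<^sub>1 t\<^sub>3\<^sub>2\<close> are replaced by \<open>t\<^sub>4\<^sub>2 t\<^sub>3\<^sub>1\<close>. After \<open>q = e\<^sup>h\<close> their
  coefficient is \<open>O(h\<^sup>i)\<close>, and each coefficient in \<open>h\<close> is a polynomial in the exponents that is
  a combination of products of binomial coefficients of order at least \<open>i\<close> in \<open>r\<close> and in \<open>s\<close>.
  Up to a constant such a product is the factor by which a pair of iterated derivatives acts on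
  monomials, and the lower bound \<open>i\<close> on the orders keeps the coefficients of the resulting
  bidifferential operator polynomial.
\<close>

section \<open>Additive maps on finitely supported functions\<close>

text \<open>The supports of \<open>f\<close>, \<open>g\<close> and \<open>f + g\<close> differ, but
  additivity forces \<open>h k 0 = 0\<close>, so every sum may be taken over a common
  support.\<close>

lemma additive_sum_keys:
  fixes h :: "'k \<Rightarrow> 'v::ab_group_add \<Rightarrow> 'w::ab_group_add"
  assumes add: "\<And>k a b. h k (a + b) = h k a + h k b"
  shows "additive (\<lambda>f. \<Sum>k\<in>Poly_Mapping.keys f. h k (Poly_Mapping.lookup f k))"
proof -
  have "h k 0 = 0" for k
    using add[of k 0 0] by simp
  then show ?thesis
    unfolding additive_def by (auto intro: setsum_keys_plus_distrib simp: add)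
qed

lemma sum_keys_single:
  assumes "h k 0 = 0"
  shows "(\<Sum>i\<in>Poly_Mapping.keys (Poly_Mapping.single k c).
    h i (Poly_Mapping.lookup (Poly_Mapping.single k c) i)) = h k c"
  using assms by (cases "c = 0") auto

lemma sum_keys_singles:
  fixes f :: "'k \<Rightarrow>\<^sub>0 'v::comm_monoid_add"
  shows "(\<Sum>k\<in>Poly_Mapping.keys f. Poly_Mapping.single k (Poly_Mapping.lookup f k)) = f"
proof (rule poly_mapping_eqI)
  fix i
  have "(\<Sum>k\<in>Poly_Mapping.keys f. Poly_Mapping.lookup (Poly_Mapping.single k (Poly_Mapping.lookup f k)) i)
      = (\<Sum>k\<in>Poly_Mapping.keys f. if k = i then Poly_Mapping.lookup f k else 0)"
    by (intro sum.cong) (auto simp: lookup_single when_def)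
  then show "Poly_Mapping.lookup
      (\<Sum>k\<in>Poly_Mapping.keys f. Poly_Mapping.single k (Poly_Mapping.lookup f k)) i
      = Poly_Mapping.lookup f i"
    by (simp add: lookup_sum in_keys_iff)
qed

text \<open>Every element is a finite sum of singles. As the coefficient \<open>c\<close> is
  arbitrary, plain additivity is enough, and one principle serves the free algebra,
  \<open>laurent\<close> and polynomials alike.\<close>

lemma additive_eqI:
  fixes S T :: "('k \<Rightarrow>\<^sub>0 'v::ab_group_add) \<Rightarrow> 'w::ab_group_add"
  assumes S: "additive S" and T: "additive T"
    and eq: "\<And>k c. S (Poly_Mapping.single k c) = T (Poly_Mapping.single k c)"
  shows "S f = T f"
proof -
  have "S (\<Sum>k\<in>Poly_Mapping.keys f. Poly_Mapping.single k (Poly_Mapping.lookup f k)) =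
      T (\<Sum>k\<in>Poly_Mapping.keys f. Poly_Mapping.single k (Poly_Mapping.lookup f k))"
    by (simp only: additive.sum[OF S] additive.sum[OF T] eq)
  then show ?thesis
    by (simp only: sum_keys_singles)
qed

lemma additive_comp: "additive S \<Longrightarrow> additive T \<Longrightarrow> additive (\<lambda>x. S (T x))"
  by (simp add: additive_def)

lemma additive_const_mult: "additive ((*) (c :: 'a::ring))"
  by (simp add: additive_def distrib_left)

lemma additive_mult_const: "additive (\<lambda>x. x * (c :: 'a::ring))"
  by (simp add: additive_def distrib_right)

lemma additive_sum_fun:
  "(\<And>i. i \<in> A \<Longrightarrow> additive (T i)) \<Longrightarrow> additive (\<lambda>x. \<Sum>i\<in>A. T i x)"
  by (simp add: additive_def sum.distrib)

lemma biadditive_eqI: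
  fixes S T :: "('k \<Rightarrow>\<^sub>0 'v::ab_group_add) \<Rightarrow> ('l \<Rightarrow>\<^sub>0 'u::ab_group_add) \<Rightarrow> 'w::ab_group_add"
  assumes "\<And>g. additive (\<lambda>f. S f g)" "\<And>f. additive (S f)"
    and "\<And>g. additive (\<lambda>f. T f g)" "\<And>f. additive (T f)"
    and "\<And>k c l d. S (Poly_Mapping.single k c) (Poly_Mapping.single l d) =
      T (Poly_Mapping.single k c) (Poly_Mapping.single l d)"
  shows "S f g = T f g"
  by (rule additive_eqI[of "\<lambda>f. S f g" "\<lambda>f. T f g"]) (auto intro: additive_eqI assms)

section \<open>Monomials and left multiplication on the PBW basis\<close>

definition mon :: "nat \<Rightarrow> nat \<Rightarrow> nat \<Rightarrow> nat \<Rightarrow> gen \<Rightarrow>\<^sub>0 nat" where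
  "mon s t u v = Poly_Mapping.single T41 s + Poly_Mapping.single T42 t +
     Poly_Mapping.single T31 u + Poly_Mapping.single T32 v"

lemma lookup_mon [simp]:
  "Poly_Mapping.lookup (mon s t u v) T41 = s"
  "Poly_Mapping.lookup (mon s t u v) T42 = t"
  "Poly_Mapping.lookup (mon s t u v) T31 = u"
  "Poly_Mapping.lookup (mon s t u v) T32 = v"
  by (simp_all add: mon_def lookup_add lookup_single)

lemma mono_eqI:
  fixes m m' :: "gen \<Rightarrow>\<^sub>0 nat"
  assumes "Poly_Mapping.lookup m T41 = Poly_Mapping.lookup m' T41"
    "Poly_Mapping.lookup m T42 = Poly_Mapping.lookup m' T42"
    "Poly_Mapping.lookup m T31 = Poly_Mapping.lookup m' T31"
    "Poly_Mapping.lookup m T32 = Poly_Mapping.lookup m' T32"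
  shows "m = m'"
proof (rule poly_mapping_eqI)
  show "Poly_Mapping.lookup m i = Poly_Mapping.lookup m' i" for i
    using assms by (cases i) auto
qed

lemma mon_exhaust:
  obtains s t u v where "m = mon s t u v"
proof
  show "m = mon (Poly_Mapping.lookup m T41) (Poly_Mapping.lookup m T42)
      (Poly_Mapping.lookup m T31) (Poly_Mapping.lookup m T32)"
    by (rule mono_eqI) simp_all
qed

lemma mon_zero [simp]: "mon 0 0 0 0 = 0"
  by (simp add: mon_def)

lemma mon_add: "mon s t u v + mon s' t' u' v' = mon (s + s') (t + t') (u + u') (v + v')"
  by (rule mono_eqI) (simp_all add: lookup_add)

lemma qpow_add: "qpow (j + k) = qpow j * qpow k"
  by (simp add: qpow_def mult_single)

lemma qpow_0 [simp]: "qpow 0 = 1"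
  by (simp add: qpow_def)

text \<open>The right-hand sides are what the defining relations give when a generator is multiplied
  from the left onto an ordered monomial and moved into place. In the last clause the truncated
  exponent of \<open>T41\<close> is harmless: at exponent 0 the coefficient is
  \<open>qpow 1 - qpow 1\<close>.\<close>

fun left_mult_mono :: "gen \<Rightarrow> (gen \<Rightarrow>\<^sub>0 nat) \<Rightarrow> laurent \<Rightarrow> laurent mpoly" where
  "left_mult_mono T41 m c = Poly_Mapping.single (m + mon 1 0 0 0) c"
| "left_mult_mono T42 m c =
     Poly_Mapping.single (m + mon 0 1 0 0) (qpow (- int (Poly_Mapping.lookup m T41)) * c)"
| "left_mult_mono T31 m c =
     Poly_Mapping.single (m + mon 0 0 1 0) (qpow (- int (Poly_Mapping.lookup m T41)) * c)"
| "left_mult_mono T32 m c =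
     Poly_Mapping.single (m + mon 0 0 0 1)
       (qpow (- int (Poly_Mapping.lookup m T42) - int (Poly_Mapping.lookup m T31)) * c) +
     Poly_Mapping.single (m - mon 1 0 0 0 + mon 0 1 1 0)
       ((qpow (1 - 2 * int (Poly_Mapping.lookup m T41)) - qpow 1) * c)"

definition left_mult :: "gen \<Rightarrow> laurent mpoly \<Rightarrow> laurent mpoly" where
  "left_mult x f = (\<Sum>m\<in>Poly_Mapping.keys f. left_mult_mono x m (Poly_Mapping.lookup f m))"

lemma left_mult_mono_add: "left_mult_mono x m (a + b) = left_mult_mono x m a + left_mult_mono x m b"
  by (cases x) (simp_all add: distrib_left single_add add_ac)

lemma additive_left_mult: "additive (left_mult x)"
  unfolding left_mult_def by (intro additive_sum_keys left_mult_mono_add)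

lemma left_mult_single: "left_mult x (Poly_Mapping.single m c) = left_mult_mono x m c"
  unfolding left_mult_def
  by (rule sum_keys_single) (use left_mult_mono_add[of x m 0 0] in simp)

lemma mon_minus: "mon s t u v - mon s' t' u' v' = mon (s - s') (t - t') (u - u') (v - v')"
  by (rule mono_eqI) (simp_all add: minus_poly_mapping.rep_eq)

lemma left_mult_mon:
  "left_mult T41 (Poly_Mapping.single (mon s t u v) c) = Poly_Mapping.single (mon (Suc s) t u v) c"
  "left_mult T42 (Poly_Mapping.single (mon s t u v) c) =
     Poly_Mapping.single (mon s (Suc t) u v) (qpow (- int s) * c)"
  "left_mult T31 (Poly_Mapping.single (mon s t u v) c) =
     Poly_Mapping.single (mon s t (Suc u) v) (qpow (- int s) * c)"
  "left_mult T32 (Poly_Mapping.single (mon s t u v) c) =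
     Poly_Mapping.single (mon s t u (Suc v)) (qpow (- int t - int u) * c) +
     Poly_Mapping.single (mon (s - 1) (Suc t) (Suc u) v) ((qpow (1 - 2 * int s) - qpow 1) * c)"
  by (simp_all add: left_mult_single mon_add mon_minus del: mon_zero)

lemma left_mult_scale:
  "left_mult x (Poly_Mapping.single 0 c * f) = Poly_Mapping.single 0 c * left_mult x f"
proof (rule additive_eqI[of "\<lambda>f. left_mult x (Poly_Mapping.single 0 c * f)"
      "\<lambda>f. Poly_Mapping.single 0 c * left_mult x f"])
  show "additive (\<lambda>f. left_mult x (Poly_Mapping.single 0 c * f))"
    "additive (\<lambda>f. Poly_Mapping.single 0 c * left_mult x f)"
    by (intro additive_comp[OF additive_left_mult] additive_comp[OF _ additive_left_mult]
        additive_const_mult)+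
  show "left_mult x (Poly_Mapping.single 0 c * Poly_Mapping.single m d) =
      Poly_Mapping.single 0 c * left_mult x (Poly_Mapping.single m d)" for m d
    by (cases x) (simp_all add: left_mult_single mult_single distrib_left mult.left_commute)
qed

section \<open>The action of the free algebra and its descent to the quotient\<close>

definition free_act :: "free_alg \<Rightarrow> laurent mpoly \<Rightarrow> laurent mpoly" where
  "free_act x f = (\<Sum>w\<in>Poly_Mapping.keys x.
     Poly_Mapping.single 0 (Poly_Mapping.lookup x w) * foldr left_mult (letters w) f)"

lemma additive_foldr_left_mult: "additive (foldr left_mult xs)"
  by (induction xs) (auto simp: additive_def id_def additive.add[OF additive_left_mult])

lemma foldr_left_mult_scale:
  "foldr left_mult xs (Poly_Mapping.single 0 c * f) = Poly_Mapping.single 0 c * foldr left_mult xs f"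
  by (induction xs) (simp_all add: left_mult_scale)

lemma additive_free_act_left: "additive (\<lambda>x. free_act x f)"
  unfolding free_act_def by (intro additive_sum_keys) (simp add: single_add distrib_right)

lemma additive_free_act_right: "additive (free_act x)"
  unfolding free_act_def
  by (intro additive_sum_fun additive_comp[OF additive_const_mult] additive_foldr_left_mult)

lemma free_act_single:
  "free_act (Poly_Mapping.single w c) f = Poly_Mapping.single 0 c * foldr left_mult (letters w) f"
  unfolding free_act_def
  by (rule sum_keys_single[of "\<lambda>w c. Poly_Mapping.single 0 c * foldr left_mult (letters w) f"]) simp

lemma free_act_mult: "free_act (x * y) f = free_act x (free_act y f)"
proof (rule biadditive_eqI[of "\<lambda>x y. free_act (x * y) f" "\<lambda>x y. free_act x (free_act y f)"])
  show "free_act (Poly_Mapping.single v c * Poly_Mapping.single w d) f =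
      free_act (Poly_Mapping.single v c) (free_act (Poly_Mapping.single w d) f)" for v c w d
    by (simp add: mult_single free_act_single plus_word_def foldr_left_mult_scale flip: mult.assoc)
qed (intro additive_free_act_left additive_comp[OF additive_free_act_left]
    additive_comp[OF additive_free_act_right] additive_const_mult additive_mult_const)+

lemma free_act_fgen: "free_act (fgen x) f = left_mult x f"
  by (simp add: fgen_def free_act_single)

lemma free_act_fscalar: "free_act (fscalar c) f = Poly_Mapping.single 0 c * f"
  by (simp add: fscalar_def free_act_single zero_word_def)

lemmas free_act_add = additive.add[OF additive_free_act_left]
lemmas free_act_diff = additive.diff[OF additive_free_act_left]

text \<open>The consistency check behind the PBW theorem: the operators \<open>left_mult x\<close>
  themselves satisfy the six relations, so the action descends to \<open>qmink\<close>.\<close>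

lemma free_act_relator:
  assumes "r \<in> relators"
  shows "free_act r f = 0"
proof (rule additive_eqI[of "free_act r" "\<lambda>_. 0"])
  show "free_act r (Poly_Mapping.single m c) = 0" for m c
  proof -
    obtain s t u v where m: "m = mon s t u v"
      by (rule mon_exhaust)
    show ?thesis
      unfolding m
      \<comment> \<open>Splitting on \<open>s\<close> isolates the exponent 0 of \<open>T41\<close>,
        where \<open>s - 1\<close> truncates.\<close>
      by (use assms[unfolded relators_def insert_iff empty_iff] in \<open>elim disjE\<close>; cases s;
          auto simp: free_act_diff free_act_add free_act_mult free_act_fgen free_act_fscalar
            left_mult_mon mult_single ring_distribs additive.add[OF additive_left_mult]
            single_diff[symmetric] single_add[symmetric]
          simp flip: qpow_add mult.assoc;
          auto simp: single_diff
            intro!: arg_cong[where f = "\<lambda>e. Poly_Mapping.single _ (qpow e * c)"])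
  qed
qed (use additive_free_act_right in \<open>simp_all add: additive_def\<close>)

lemma free_act_rel_ideal: "x \<in> rel_ideal \<Longrightarrow> free_act x f = 0"
  by (induction arbitrary: f rule: rel_ideal.induct)
    (simp_all add: free_act_add free_act_mult free_act_relator
      additive.zero[OF additive_free_act_left] additive.zero[OF additive_free_act_right])

lift_definition qact :: "qmink \<Rightarrow> laurent mpoly \<Rightarrow> laurent mpoly" is free_act
proof -
  fix x y assume "rel_cong x y"
  then have "free_act (x - y) f = 0" for f
    by (simp add: rel_cong_def free_act_rel_ideal)
  then show "free_act x = free_act y"
    by (intro ext) (simp add: free_act_diff)
qed

lemma additive_qact: "additive (\<lambda>x. qact x f)"
  unfolding additive_def by transfer (simp add: free_act_add)

lemma additive_qact_right: "additive (qact x)"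
  by transfer (rule additive_free_act_right)

lemma qact_mult: "qact (x * y) f = qact x (qact y f)"
  by transfer (rule free_act_mult)

lemma qact_one: "qact 1 f = f"
proof (transfer)
  fix f
  show "free_act 1 f = f"
    using free_act_fscalar[of 1 f] by (simp add: fscalar_def)
qed

lemma qact_tgen: "qact (tgen x) = left_mult x"
  by (transfer) (simp add: fun_eq_iff free_act_fgen)

lemma qact_tscalar: "qact (tscalar c) f = Poly_Mapping.single 0 c * f"
  by transfer (rule free_act_fscalar)

lemma qact_power: "qact (x ^ n) f = (qact x ^^ n) f"
  by (induction n) (simp_all add: qact_one qact_mult)

section \<open>The star product through the action\<close>

lemma tscalar_add: "tscalar (a + b) = tscalar a + tscalar b"
  by transfer (simp add: fscalar_def single_add rel_cong_def rel_ideal.zero)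

lemma tscalar_diff: "tscalar (a - b) = tscalar a - tscalar b"
  by transfer (simp add: fscalar_def single_diff rel_cong_def rel_ideal.zero)

lemma tscalar_mult: "tscalar (a * b) = tscalar a * tscalar b"
  by transfer (simp add: fscalar_def mult_single rel_cong_def rel_ideal.zero)

lemma tscalar_one [simp]: "tscalar 1 = 1"
  by transfer (simp add: fscalar_def rel_cong_def rel_ideal.zero)

text \<open>Already in the free algebra scalars are central: they sit at the empty word, and
  \<open>laurent\<close> is commutative.\<close>

lemma tscalar_commute: "x * tscalar c = tscalar c * x"
proof transfer
  fix x :: free_alg and c
  have "x * fscalar c = fscalar c * x"
  proof (rule additive_eqI[of "\<lambda>x. x * fscalar c" "(*) (fscalar c)"])
    show "Poly_Mapping.single w d * fscalar c = fscalar c * Poly_Mapping.single w d" for w d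
      by (simp add: fscalar_def mult_single mult.commute)
  qed (rule additive_mult_const additive_const_mult)+
  then show "rel_cong (x * fscalar c) (fscalar c * x)"
    by (simp add: rel_cong_def rel_ideal.zero)
qed

lemma tgen_relations:
  "tgen T42 * tgen T41 = tscalar (qpow (-1)) * (tgen T41 * tgen T42)"
  "tgen T31 * tgen T41 = tscalar (qpow (-1)) * (tgen T41 * tgen T31)"
  "tgen T32 * tgen T41 =
    tgen T41 * tgen T32 + tscalar (qpow (-1) - qpow 1) * (tgen T42 * tgen T31)"
  "tgen T31 * tgen T42 = tgen T42 * tgen T31"
  "tgen T32 * tgen T42 = tscalar (qpow (-1)) * (tgen T42 * tgen T32)"
  "tgen T32 * tgen T31 = tscalar (qpow (-1)) * (tgen T31 * tgen T32)"
proof -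
  have *: "r \<in> relators \<Longrightarrow> r \<in> rel_ideal" for r
    using rel_ideal.gen[of r 1 1] by simp
  note ** = *[unfolded relators_def, unfolded insert_iff]
  show "tgen T42 * tgen T41 = tscalar (qpow (-1)) * (tgen T41 * tgen T42)"
    "tgen T31 * tgen T41 = tscalar (qpow (-1)) * (tgen T41 * tgen T31)"
    "tgen T32 * tgen T41 =
    tgen T41 * tgen T32 + tscalar (qpow (-1) - qpow 1) * (tgen T42 * tgen T31)"
    "tgen T31 * tgen T42 = tgen T42 * tgen T31"
    "tgen T32 * tgen T42 = tscalar (qpow (-1)) * (tgen T42 * tgen T32)"
    "tgen T32 * tgen T31 = tscalar (qpow (-1)) * (tgen T31 * tgen T32)"
    by (transfer, unfold rel_cong_def, rule **, blast)+
qed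

definition pbw :: "(gen \<Rightarrow>\<^sub>0 nat) \<Rightarrow> qmink" where
  "pbw m = tgen T41 ^ Poly_Mapping.lookup m T41 * tgen T42 ^ Poly_Mapping.lookup m T42 *
      tgen T31 ^ Poly_Mapping.lookup m T31 * tgen T32 ^ Poly_Mapping.lookup m T32"

lemma Q_altdef: "Q f = (\<Sum>m\<in>Poly_Mapping.keys f. tscalar (Poly_Mapping.lookup f m) * pbw m)"
  by (simp add: Q_def pbw_def)

lemma additive_Q: "additive Q"
  unfolding Q_altdef by (intro additive_sum_keys) (simp add: tscalar_add distrib_right)

lemma Q_single: "Q (Poly_Mapping.single m c) = tscalar c * pbw m"
  unfolding Q_altdef
  by (rule sum_keys_single) (use tscalar_diff[of 0 0] in simp)

lemma pow_q_commute:
  assumes "y * x = tscalar c * (x * y)"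
  shows "y * x ^ n = tscalar (c ^ n) * (x ^ n * y)"
proof (induction n)
  case (Suc n)
  have "y * x ^ Suc n = (y * x) * x ^ n"
    by (simp add: mult.assoc)
  also have "\<dots> = tscalar c * x * (y * x ^ n)"
    by (simp add: assms mult.assoc)
  also have "\<dots> = tscalar c * x * (tscalar (c ^ n) * (x ^ n * y))"
    by (simp only: Suc)
  also have "\<dots> = tscalar c * (x * tscalar (c ^ n)) * x ^ n * y"
    by (simp only: mult.assoc)
  also have "\<dots> = tscalar (c ^ Suc n) * (x ^ Suc n * y)"
    by (simp add: tscalar_commute[of x] tscalar_mult mult.assoc)
  finally show ?case .
qed simp

lemma qpow_power: "qpow k ^ n = qpow (k * int n)"
  by (induction n) (simp_all add: distrib_left qpow_add)

lemmas tgen_power_commute =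
  tgen_relations(1)[THEN pow_q_commute, unfolded qpow_power]
  tgen_relations(2)[THEN pow_q_commute, unfolded qpow_power]
  tgen_relations(5)[THEN pow_q_commute, unfolded qpow_power]
  tgen_relations(6)[THEN pow_q_commute, unfolded qpow_power]

lemma T31_T42_power: "tgen T31 * tgen T42 ^ n = tgen T42 ^ n * tgen T31"
  using pow_q_commute[of "tgen T31" "tgen T42" 1 n] tgen_relations(4) by simp

lemma tscalar_left_commute: "x * (tscalar c * y) = tscalar c * (x * y)"
  by (simp add: tscalar_commute[of x] flip: mult.assoc)

lemmas tscalar_past =
  tscalar_left_commute[of "tgen x" for x] tscalar_left_commute[of "tgen x ^ n" for x n]

text \<open>Each passage over a factor t41 creates (q^-1 - q) t42 t31, and moving t42 t31 past a
  further t41 costs q^-2. The coefficient is the geometric sum (q^-1 - q)(1 + q^-2 + ... +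
  q^(-2(s-1))) = q^(1-2s) - q.\<close>

lemma T32_mult_T41_power:
  "tgen T32 * tgen T41 ^ s = tgen T41 ^ s * tgen T32 +
     tscalar (qpow (1 - 2 * int s) - qpow 1) * (tgen T41 ^ (s - 1) * (tgen T42 * tgen T31))"
proof (induction s)
  case 0
  show ?case
    using tscalar_diff[of 0 0] by simp
next
  case (Suc s)
  have bca: "tgen T42 * tgen T31 * tgen T41 = tscalar (qpow (-2)) * (tgen T41 * (tgen T42 * tgen T31))"
  proof -
    have "tgen T42 * tgen T31 * tgen T41 = tscalar (qpow (-1)) * (tgen T42 * tgen T41 * tgen T31)"
      by (simp add: mult.assoc tgen_relations(2) tscalar_past)
    also have "\<dots> = tscalar (qpow (-1) * qpow (-1)) * (tgen T41 * (tgen T42 * tgen T31))"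
      by (simp only: tgen_relations(1) mult.assoc tscalar_mult)
    finally show ?thesis
      by (simp flip: qpow_add)
  qed
  let ?k = "qpow (1 - 2 * int s) - qpow 1"
  \<comment> \<open>For \<open>s = 0\<close> the powers of t41 do not match, but then
    \<open>?k\<close> is zero.\<close>
  have low: "tscalar ?k * (tgen T41 ^ (s - 1) * (tgen T41 * x)) = tscalar ?k * (tgen T41 ^ s * x)" for x
    using tscalar_diff[of 0 0] by (cases s) (simp_all add: mult.assoc power_Suc2 del: power_Suc)
  have "tgen T32 * tgen T41 ^ Suc s = (tgen T32 * tgen T41 ^ s) * tgen T41"
    by (simp only: power_Suc2 mult.assoc)
  also have "\<dots> = tgen T41 ^ s * (tgen T32 * tgen T41) +
      tscalar ?k * (tgen T41 ^ (s - 1) * (tgen T42 * tgen T31 * tgen T41))"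
    by (simp only: Suc distrib_right mult.assoc)
  also have "\<dots> = tgen T41 ^ Suc s * tgen T32 +
      tscalar (qpow (-1) - qpow 1) * (tgen T41 ^ s * (tgen T42 * tgen T31)) +
      tscalar ?k * (tscalar (qpow (-2)) * (tgen T41 ^ s * (tgen T42 * tgen T31)))"
    by (simp only: tgen_relations(3) bca[unfolded mult.assoc] distrib_left tscalar_past
        low tscalar_left_commute[of "tscalar ?k"] power_Suc2 mult.assoc)
  also have "\<dots> = tgen T41 ^ Suc s * tgen T32 +
      tscalar (qpow (-1) - qpow 1 + ?k * qpow (-2)) * (tgen T41 ^ s * (tgen T42 * tgen T31))"
    by (simp only: tscalar_add tscalar_mult distrib_right mult.assoc add.assoc)
  also have "qpow (-1) - qpow 1 + ?k * qpow (-2) = qpow (1 - 2 * int (Suc s)) - qpow 1"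
    by (simp add: left_diff_distrib flip: qpow_add)
  finally show ?case
    by simp
qed

lemma pbw_mon: "pbw (mon s t u v) = tgen T41 ^ s * (tgen T42 ^ t * (tgen T31 ^ u * tgen T32 ^ v))"
  by (simp add: pbw_def mult.assoc)

lemma mult_left_assoc: "x * y = z \<Longrightarrow> x * (y * w) = z * (w :: 'a::semigroup_mult)"
  by (metis mult.assoc)

text \<open>Confirms that the formulas for \<open>left_mult\<close> describe the actual
  multiplication in \<open>qmink\<close>: \<open>Q\<close> intertwines the two.\<close>

lemma Q_left_mult: "Q (left_mult x f) = tgen x * Q f"
proof (rule additive_eqI[of "\<lambda>f. Q (left_mult x f)" "\<lambda>f. tgen x * Q f"])
  show "Q (left_mult x (Poly_Mapping.single m c)) = tgen x * Q (Poly_Mapping.single m c)" for m c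
  proof -
    obtain s t u v where m: "m = mon s t u v"
      by (rule mon_exhaust)
    have "Q (left_mult x (Poly_Mapping.single m c)) = tscalar c * (tgen x * pbw m)"
    proof (cases x)
      case T32
      have exp: "tscalar (qpow (- int t - int u)) = tscalar (qpow (- int t)) * tscalar (qpow (- int u))"
        by (simp flip: tscalar_mult qpow_add)
      have "tgen T32 * pbw m = tscalar (qpow (- int t - int u)) * pbw (mon s t u (Suc v)) +
          tscalar (qpow (1 - 2 * int s) - qpow 1) * pbw (mon (s - 1) (Suc t) (Suc u) v)"
        unfolding m pbw_mon
        by (simp add: tgen_power_commute[THEN mult_left_assoc] T31_T42_power[THEN mult_left_assoc]
            T32_mult_T41_power[THEN mult_left_assoc] distrib_right distrib_left mult.assoc
            tscalar_past exp)
      then show ?thesis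
        by (simp add: T32 m left_mult_mon additive.add[OF additive_Q] Q_single distrib_left
            mult.commute[of c] flip: tscalar_mult mult.assoc)
    qed (simp_all add: m left_mult_mon Q_single pbw_mon mult.assoc tscalar_mult
        tgen_power_commute[THEN mult_left_assoc] T31_T42_power[THEN mult_left_assoc]
        tscalar_past tscalar_left_commute[of "tscalar c"])
    then show ?thesis
      by (simp add: Q_single tscalar_past)
  qed
qed (intro additive_comp[OF additive_Q] additive_comp[OF additive_const_mult]
    additive_left_mult additive_Q)+

lemma Q_scale: "Q (Poly_Mapping.single 0 c * f) = tscalar c * Q f"
proof (rule additive_eqI[of "\<lambda>f. Q (Poly_Mapping.single 0 c * f)" "\<lambda>f. tscalar c * Q f"])
  show "Q (Poly_Mapping.single 0 c * Poly_Mapping.single m d) = tscalar c * Q (Poly_Mapping.single m d)" for m d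
    by (simp add: mult_single Q_single tscalar_mult mult.assoc)
qed (intro additive_comp[OF additive_Q] additive_comp[OF additive_const_mult]
    additive_const_mult additive_Q)+

lemma qact_pbw:
  "qact (pbw m) f = (left_mult T41 ^^ Poly_Mapping.lookup m T41) ((left_mult T42 ^^ Poly_Mapping.lookup m T42)
     ((left_mult T31 ^^ Poly_Mapping.lookup m T31) ((left_mult T32 ^^ Poly_Mapping.lookup m T32) f)))"
  by (simp add: pbw_def qact_mult qact_power qact_tgen)

lemma Q_left_mult_power: "Q ((left_mult x ^^ n) f) = tgen x ^ n * Q f"
  by (induction n) (simp_all add: Q_left_mult mult.assoc)

lemma Q_qact_pbw: "Q (qact (pbw m) f) = pbw m * Q f"
  by (simp only: qact_pbw Q_left_mult_power) (simp only: pbw_def mult.assoc)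

text \<open>Exhibits a preimage under \<open>Q\<close> of the product; injectivity of
  \<open>Q\<close> then identifies it with the star product.\<close>

lemma Q_qact: "Q (qact (Q f) g) = Q f * Q g"
proof (rule additive_eqI[of "\<lambda>f. Q (qact (Q f) g)" "\<lambda>f. Q f * Q g"])
  show "Q (qact (Q (Poly_Mapping.single m c)) g) = Q (Poly_Mapping.single m c) * Q g" for m c
    by (simp add: Q_single qact_mult qact_tscalar Q_scale Q_qact_pbw mult.assoc)
qed (intro additive_comp[OF additive_Q] additive_comp[OF additive_qact] additive_Q
    additive_comp[OF additive_mult_const])+

lemma left_mult_power_mon:
  "(left_mult T41 ^^ n) (Poly_Mapping.single (mon s t u v) c) = Poly_Mapping.single (mon (s + n) t u v) c"
  "(left_mult T42 ^^ n) (Poly_Mapping.single (mon s t u v) c) =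
     Poly_Mapping.single (mon s (t + n) u v) (qpow (- int n * int s) * c)"
  "(left_mult T31 ^^ n) (Poly_Mapping.single (mon s t u v) c) =
     Poly_Mapping.single (mon s t (u + n) v) (qpow (- int n * int s) * c)"
proof -
  have *: "qpow (- int s) * (qpow (- (int n * int s)) * d) = qpow (- (int (Suc n) * int s)) * d" for n d
    by (simp add: distrib_right flip: mult.assoc qpow_add)
  show "(left_mult T41 ^^ n) (Poly_Mapping.single (mon s t u v) c) = Poly_Mapping.single (mon (s + n) t u v) c"
    by (induction n) (simp_all add: left_mult_mon)
  show "(left_mult T42 ^^ n) (Poly_Mapping.single (mon s t u v) c) =
     Poly_Mapping.single (mon s (t + n) u v) (qpow (- int n * int s) * c)"
    by (induction n arbitrary: t c) (simp_all add: left_mult_mon funpow_swap1 * del: of_nat_Suc)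
  show "(left_mult T31 ^^ n) (Poly_Mapping.single (mon s t u v) c) =
     Poly_Mapping.single (mon s t (u + n) v) (qpow (- int n * int s) * c)"
    by (induction n arbitrary: u c) (simp_all add: left_mult_mon funpow_swap1 * del: of_nat_Suc)
qed

lemma left_mult_T32_power_one:
  "(left_mult T32 ^^ n) 1 = Poly_Mapping.single (mon 0 0 0 n) 1"
proof (induction n)
  case (Suc n)
  then show ?case
    by (simp add: left_mult_mon)
qed simp

text \<open>Building an ordered monomial from 1, starting with t32 and ending with t41, never moves
  a generator past another one, so no power of q appears. This gives \<open>Q\<close> a left
  inverse.\<close>

lemma qact_Q_one: "qact (Q f) 1 = f"
proof (rule additive_eqI[of "\<lambda>f. qact (Q f) 1" "\<lambda>f. f"])
  show "qact (Q (Poly_Mapping.single m c)) 1 = Poly_Mapping.single m c" for m c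
  proof -
    obtain s t u v where m: "m = mon s t u v"
      by (rule mon_exhaust)
    show ?thesis
      unfolding m by (simp add: Q_single qact_mult qact_tscalar qact_pbw left_mult_T32_power_one
        left_mult_power_mon mult_single)
  qed
qed (intro additive_comp[OF additive_qact] additive_Q, simp add: additive_def)

lemma inj_Q: "inj Q"
  by (metis injI qact_Q_one)

lemma star_eq_qact: "star f g = qact (Q f) g"
  unfolding star_def using Q_qact[of f g] inj_Q by (metis inv_f_f)

section \<open>The star product of two monomials\<close>

text \<open>
  The coefficient of \<open>t\<^sub>4\<^sub>1\<^bsup>s - i\<^esup> t\<^sub>4\<^sub>2\<^sup>i t\<^sub>3\<^sub>1\<^sup>i t\<^sub>3\<^sub>2\<^bsup>r - i\<^esup>\<close> in \<open>t\<^sub>3\<^sub>2\<^sup>r t\<^sub>4\<^sub>1\<^sup>s\<close>.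
  Since it vanishes unless \<open>i \<le> min r s\<close>, truncated subtraction is harmless.
\<close>

fun reorder_coeff :: "nat \<Rightarrow> nat \<Rightarrow> nat \<Rightarrow> laurent" where
  "reorder_coeff 0 r s = 1"
| "reorder_coeff (Suc i) 0 s = 0"
| "reorder_coeff (Suc i) (Suc r) s = reorder_coeff (Suc i) r s +
     (qpow (1 - 2 * int s) - qpow 1) * qpow (- 2 * (int r - int i)) * reorder_coeff i r (s - 1)"

text \<open>At \<open>s = 0\<close> the factor \<open>qpow 1 - qpow 1\<close> kills the recursive
  term, so the truncated \<open>s - 1\<close> contributes nothing.\<close>

lemma reorder_coeff_eq_0: "r < i \<or> s < i \<Longrightarrow> reorder_coeff i r s = 0"
proof (induction i r s rule: reorder_coeff.induct)
  case (3 i r s)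
  then show ?case
    by (cases s) auto
qed auto

lemma additive_funpow: "additive (T :: 'a::ab_group_add \<Rightarrow> 'a) \<Longrightarrow> additive (T ^^ n)"
  by (induction n) (simp_all add: additive_def)

text \<open>The innermost t32 either passes t41^s, raising \<open>v\<close>, or turns one t41 into
  t42 t31, lowering \<open>s\<close> and raising \<open>t\<close> and \<open>u\<close>. In the
  second case the raised \<open>t + u\<close> accounts for the factor
  \<open>qpow (- 2 * (int r - int i))\<close> in the recursion of
  \<open>reorder_coeff\<close>.\<close>

lemma left_mult_T32_power_mon:
  "(left_mult T32 ^^ r) (Poly_Mapping.single (mon s t u v) c) =
    (\<Sum>i\<le>r. Poly_Mapping.single (mon (s - i) (t + i) (u + i) (v + (r - i)))
      (qpow (- (int t + int u) * (int r - int i)) * reorder_coeff i r s * c))"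
proof (induction r arbitrary: s t u v c)
  case (Suc r)
  define mo where "mo i = mon (s - i) (t + i) (u + i) (v + (Suc r - i))" for i
  define k where "k = qpow (1 - 2 * int s) - qpow 1"
  define X where "X i = Poly_Mapping.single (mo i)
    (qpow (- (int t + int u) * (int (Suc r) - int i)) * reorder_coeff i r s * c)" for i
  define Y where "Y i = Poly_Mapping.single (mo (Suc i))
    (qpow (- (int t + int u) * (int r - int i)) *
     (k * qpow (- 2 * (int r - int i)) * reorder_coeff i r (s - 1)) * c)" for i
  define R where "R i = Poly_Mapping.single (mo i)
    (qpow (- (int t + int u) * (int (Suc r) - int i)) * reorder_coeff i (Suc r) s * c)" for i
  have R: "R 0 = X 0" "R (Suc i) = X (Suc i) + Y i" for i
    by (simp_all add: R_def X_def Y_def k_def distrib_left distrib_right single_add)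
  have X: "(left_mult T32 ^^ r) (Poly_Mapping.single (mon s t u (Suc v)) (qpow (- int t - int u) * c))
      = (\<Sum>i\<le>r. X i)"
    unfolding Suc
  proof (rule sum.cong)
    fix i assume "i \<in> {..r}"
    moreover have "qpow (- (int t + int u) * (int (Suc r) - int i)) =
        qpow (- (int t + int u) * (int r - int i)) * qpow (- int t - int u)"
      by (simp add: algebra_simps flip: qpow_add)
    ultimately show "Poly_Mapping.single (mon (s - i) (t + i) (u + i) (Suc v + (r - i)))
        (qpow (- (int t + int u) * (int r - int i)) * reorder_coeff i r s * (qpow (- int t - int u) * c)) = X i"
      by (simp add: X_def mo_def mult_ac Suc_diff_le)
  qed simp
  have Y: "(left_mult T32 ^^ r) (Poly_Mapping.single (mon (s - 1) (Suc t) (Suc u) v) (k * c))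
      = (\<Sum>i\<le>r. Y i)"
    unfolding Suc
  proof (rule sum.cong)
    fix i assume "i \<in> {..r}"
    moreover have "qpow (- (int (Suc t) + int (Suc u)) * (int r - int i)) =
        qpow (- (int t + int u) * (int r - int i)) * qpow (- 2 * (int r - int i))"
      by (simp add: algebra_simps flip: qpow_add)
    ultimately show "Poly_Mapping.single (mon (s - 1 - i) (Suc t + i) (Suc u + i) (v + (r - i)))
        (qpow (- (int (Suc t) + int (Suc u)) * (int r - int i)) * reorder_coeff i r (s - 1) * (k * c)) = Y i"
      by (simp add: Y_def mo_def mult_ac)
  qed simp
  have "(left_mult T32 ^^ Suc r) (Poly_Mapping.single (mon s t u v) c) = (\<Sum>i\<le>r. X i) + (\<Sum>i\<le>r. Y i)"
    unfolding funpow_Suc_right o_apply left_mult_mon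
    by (simp only: additive.add[OF additive_funpow[OF additive_left_mult]] X Y flip: k_def)
  \<comment> \<open>The added term vanishes, since \<open>reorder_coeff (Suc r) r s = 0\<close>.
    Next, \<open>Y i\<close> is matched with index \<open>Suc i\<close>, because its step has
    already used one pair.\<close>
  also have "(\<Sum>i\<le>r. X i) = (\<Sum>i\<le>Suc r. X i)"
    by (simp add: X_def reorder_coeff_eq_0)
  also have "(\<Sum>i\<le>Suc r. X i) + (\<Sum>i\<le>r. Y i) = (\<Sum>i\<le>Suc r. R i)"
    by (simp add: sum.atMost_Suc_shift R sum.distrib add.assoc del: sum.atMost_Suc)
  finally show ?case
    by (simp only: R_def mo_def)
qed simp

text \<open>The two products come from moving t42 and t31 of the left factor past the remaining t41,
  and the remaining t32 past t42 and t31 of the right factor. \<open>Inl\<close> and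
  \<open>Inr\<close> mark the exponents of the left and right factor, so that all eight form a
  single argument.\<close>

definition twist_exponent :: "(gen + gen \<Rightarrow> nat) \<Rightarrow> nat \<Rightarrow> int" where
  "twist_exponent m i =
     - (int (m (Inl T42)) + int (m (Inl T31))) * (int (m (Inr T41)) - int i)
     - (int (m (Inr T42)) + int (m (Inr T31))) * (int (m (Inl T32)) - int i)"

definition star_mono_coeff :: "nat \<Rightarrow> (gen + gen \<Rightarrow> nat) \<Rightarrow> laurent" where
  "star_mono_coeff i m = qpow (twist_exponent m i) * reorder_coeff i (m (Inl T32)) (m (Inr T41))"

definition star_mono :: "nat \<Rightarrow> (gen \<Rightarrow>\<^sub>0 nat) \<Rightarrow> (gen \<Rightarrow>\<^sub>0 nat) \<Rightarrow> gen \<Rightarrow>\<^sub>0 nat" where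
  "star_mono i m m' = (m + m' - mon i 0 0 i) + mon 0 i i 0"

abbreviation exponents :: "(gen \<Rightarrow>\<^sub>0 nat) \<Rightarrow> (gen \<Rightarrow>\<^sub>0 nat) \<Rightarrow> gen + gen \<Rightarrow> nat" where
  "exponents m m' \<equiv> case_sum (Poly_Mapping.lookup m) (Poly_Mapping.lookup m')"

lemma qact_Q_single:
  "qact (Q (Poly_Mapping.single m c)) f = Poly_Mapping.single 0 c * qact (pbw m) f"
  by (simp add: Q_single qact_mult qact_tscalar)

lemma star_single:
  "star (Poly_Mapping.single m c) (Poly_Mapping.single m' d) =
    (\<Sum>i\<le>Poly_Mapping.lookup m T32.
      Poly_Mapping.single (star_mono i m m') (star_mono_coeff i (exponents m m') * (c * d)))"
proof -
  obtain k n p r where m: "m = mon k n p r"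
    by (rule mon_exhaust)
  obtain s t u v where m': "m' = mon s t u v"
    by (rule mon_exhaust)
  let ?T = "\<lambda>i. (left_mult T41 ^^ k) ((left_mult T42 ^^ n) ((left_mult T31 ^^ p)
    (Poly_Mapping.single (mon (s - i) (t + i) (u + i) (v + (r - i)))
      (qpow (- (int t + int u) * (int r - int i)) * reorder_coeff i r s * d))))"
  have "star (Poly_Mapping.single m c) (Poly_Mapping.single m' d) =
      (\<Sum>i\<le>r. Poly_Mapping.single 0 c * ?T i)"
    by (simp add: star_eq_qact qact_Q_single qact_pbw m m' left_mult_T32_power_mon
        additive.sum[OF additive_funpow[OF additive_left_mult]] sum_distrib_left)
  also have "\<dots> = (\<Sum>i\<le>r. Poly_Mapping.single (star_mono i m m')
      (star_mono_coeff i (exponents m m') * (c * d)))"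
  proof (rule sum.cong)
    fix i assume i: "i \<in> {..r}"
    show "Poly_Mapping.single 0 c * ?T i = Poly_Mapping.single (star_mono i m m')
        (star_mono_coeff i (exponents m m') * (c * d))"
    \<comment> \<open>For \<open>s < i\<close> truncation may make the two monomials differ, but
      both coefficients are then zero.\<close>
    proof (cases "i \<le> s")
      case True
      have mono: "star_mono i m m' = mon (s - i + k) (t + i + n) (u + i + p) (v + (r - i))"
        using True i by (simp add: star_mono_def m m' mon_add mon_minus add_ac)
      let ?q1 = "qpow (- int n * int (s - i))" and ?q2 = "qpow (- int p * int (s - i))"
        and ?q3 = "qpow (- (int t + int u) * (int r - int i))"
      have q: "?q1 * (?q2 * ?q3) = qpow (twist_exponent (exponents m m') i)"
        using True by (simp add: twist_exponent_def m m' of_nat_diff algebra_simps flip: qpow_add)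
      have "c * (?q1 * (?q2 * (?q3 * reorder_coeff i r s * d))) =
          ?q1 * (?q2 * ?q3) * reorder_coeff i r s * (c * d)"
        by (simp only: mult_ac)
      also have "\<dots> = star_mono_coeff i (exponents m m') * (c * d)"
        unfolding q by (simp add: star_mono_coeff_def m m')
      finally show ?thesis
        by (simp only: mono left_mult_power_mon mult_single add_0)
    next
      case False
      then show ?thesis
        unfolding left_mult_power_mon by (simp add: star_mono_coeff_def reorder_coeff_eq_0 m m')
    qed
  qed simp
  finally show ?thesis
    by (simp add: m)
qed

section \<open>Expansion in powers of h\<close>

lemma fps_exp_powi: "fps_exp (1 :: complex) powi k = fps_exp (of_int k)"
  by (cases "k \<ge> 0") (simp_all add: power_int_def fps_exp_power_mult flip: fps_exp_neg)

lemma additive_subst_exp: "additive subst_exp"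
  unfolding subst_exp_def
  by (intro additive_sum_keys) (simp add: distrib_right flip: fps_const_add)

lemma subst_exp_single: "subst_exp (Poly_Mapping.single k c) = fps_const c * fps_exp (of_int k)"
  unfolding subst_exp_def fps_exp_powi by (rule sum_keys_single) simp

lemma subst_exp_mult: "subst_exp (a * b) = subst_exp a * subst_exp b"
proof (rule biadditive_eqI[of "\<lambda>a b. subst_exp (a * b)" "\<lambda>a b. subst_exp a * subst_exp b"])
  show "subst_exp (Poly_Mapping.single k c * Poly_Mapping.single l d) =
      subst_exp (Poly_Mapping.single k c) * subst_exp (Poly_Mapping.single l d)" for k c l d
    by (simp add: mult_single subst_exp_single fps_exp_add_mult mult_ac flip: fps_const_mult)
qed (intro additive_comp[OF additive_subst_exp] additive_const_mult additive_mult_const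
    additive_comp[OF additive_const_mult] additive_comp[OF additive_mult_const] additive_subst_exp)+

lemma subst_exp_qpow: "subst_exp (qpow k) = fps_exp (of_int k)"
  by (simp add: qpow_def subst_exp_single)

lemma subst_exp_one: "subst_exp 1 = 1"
  using subst_exp_qpow[of 0] by simp

text \<open>\<open>Poly_Mapping.map\<close> skips zero coefficients; since an additive
  \<open>T\<close> fixes 0, it is pointwise application of \<open>T\<close>.\<close>

lemma additive_map_poly_mapping:
  assumes "additive T"
  shows "additive (Poly_Mapping.map T)"
  unfolding additive_def
proof (intro allI poly_mapping_eqI)
  have lookup: "Poly_Mapping.lookup (Poly_Mapping.map T f) k = T (Poly_Mapping.lookup f k)" for f k
    by (simp add: Poly_Mapping.map.rep_eq when_def additive.zero[OF assms])
  show "Poly_Mapping.lookup (Poly_Mapping.map T (f + g)) k =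
      Poly_Mapping.lookup (Poly_Mapping.map T f + Poly_Mapping.map T g) k" for f g k
    by (simp add: lookup lookup_add additive.add[OF assms])
qed

lemma additive_embed: "additive embed"
  unfolding embed_def by (intro additive_map_poly_mapping) (simp add: additive_def single_add)

lemma embed_single: "embed (Poly_Mapping.single m c) = Poly_Mapping.single m (Poly_Mapping.single 0 c)"
  by (simp add: embed_def when_def)

lemma additive_h_coeff: "additive (\<lambda>a. fps_nth (subst_exp a) j)"
  by (simp add: additive_def additive.add[OF additive_subst_exp])

lemma additive_h_expand_nth: "additive (\<lambda>F. fps_nth (h_expand F) j)"
  unfolding h_expand_def fps_nth_Abs_fps by (intro additive_map_poly_mapping additive_h_coeff)

lemma h_expand_single_nth:
  "fps_nth (h_expand (Poly_Mapping.single m a)) j = Poly_Mapping.single m (fps_nth (subst_exp a) j)"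
  using additive.zero[OF additive_subst_exp] by (simp add: h_expand_def when_def)

lemma additive_star_coeff_left: "additive (\<lambda>f. star_coeff j f g)"
  unfolding star_coeff_def star_eq_qact
  by (intro additive_comp[OF additive_h_expand_nth] additive_comp[OF additive_qact]
      additive_comp[OF additive_Q] additive_embed)

lemma additive_star_coeff_right: "additive (star_coeff j f)"
  unfolding star_coeff_def star_eq_qact
  by (intro additive_comp[OF additive_h_expand_nth] additive_comp[OF additive_qact_right]
      additive_embed)

lemma star_coeff_single:
  "star_coeff j (Poly_Mapping.single m c) (Poly_Mapping.single m' d) =
    (\<Sum>i\<le>Poly_Mapping.lookup m T32. Poly_Mapping.single (star_mono i m m')
      (fps_nth (subst_exp (star_mono_coeff i (exponents m m'))) j * (c * d)))"
  unfolding star_coeff_def embed_single star_single additive.sum[OF additive_h_expand_nth]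
    h_expand_single_nth subst_exp_mult
  by (simp add: subst_exp_single flip: mult.assoc)

section \<open>Functions spanned by products of binomial coefficients\<close>

definition binom_prod :: "('i::finite \<Rightarrow> nat) \<Rightarrow> ('i \<Rightarrow> nat) \<Rightarrow> complex" where
  "binom_prod k m = (\<Prod>i\<in>UNIV. of_nat (m i choose k i))"

text \<open>Linear combinations of Newton basis elements. The bound \<open>K\<close> records
  vanishing: every member is zero at \<open>m\<close> as soon as some
  \<open>m i < K i\<close>.\<close>

inductive_set binom_span :: "('i::finite \<Rightarrow> nat) \<Rightarrow> (('i \<Rightarrow> nat) \<Rightarrow> complex) set"
  for K where
    base: "(\<And>i. K i \<le> k i) \<Longrightarrow> (\<lambda>m. c * binom_prod k m) \<in> binom_span K"
  | add: "\<phi> \<in> binom_span K \<Longrightarrow> \<psi> \<in> binom_span K \<Longrightarrow> (\<lambda>m. \<phi> m + \<psi> m) \<in> binom_span K"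

inductive_set poly_fun :: "(('i::finite \<Rightarrow> nat) \<Rightarrow> complex) set" where
    const: "(\<lambda>m. c) \<in> poly_fun"
  | coord: "(\<lambda>m. of_nat (m i)) \<in> poly_fun"
  | add: "\<phi> \<in> poly_fun \<Longrightarrow> \<psi> \<in> poly_fun \<Longrightarrow> (\<lambda>m. \<phi> m + \<psi> m) \<in> poly_fun"
  | mult: "\<phi> \<in> poly_fun \<Longrightarrow> \<psi> \<in> poly_fun \<Longrightarrow> (\<lambda>m. \<phi> m * \<psi> m) \<in> poly_fun"

lemma binom_prod_remove:
  "binom_prod k m = of_nat (m i choose k i) * (\<Prod>j\<in>UNIV - {i}. of_nat (m j choose k j))"
  unfolding binom_prod_def by (rule prod.remove) auto

lemma binom_prod_update:
  "binom_prod (k(i := a)) (m(i := b)) =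
    of_nat (b choose a) * (\<Prod>j\<in>UNIV - {i}. of_nat (m j choose k j))"
  by (simp add: binom_prod_remove[of _ _ i])

lemma binom_prod_update_left:
  "binom_prod (k(i := a)) m = of_nat (m i choose a) * (\<Prod>j\<in>UNIV - {i}. of_nat (m j choose k j))"
  using binom_prod_update[of k i a m "m i"] by simp

lemma binom_prod_update_right:
  "binom_prod k (m(i := b)) = of_nat (b choose k i) * (\<Prod>j\<in>UNIV - {i}. of_nat (m j choose k j))"
  using binom_prod_update[of k i "k i" m b] by simp

text \<open>Only orders \<open>k\<close> and \<open>Suc k\<close> occur, so multiplying by a
  coordinate never lowers an order. It follows from absorption and Pascal's rule.\<close>

lemma times_binomial: "n * (n choose k) = k * (n choose k) + Suc k * (n choose Suc k)"
proof -
  have "Suc n * (n choose k) = Suc k * (n choose k) + Suc k * (n choose Suc k)"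
    unfolding Suc_times_binomial_eq binomial_Suc_Suc by (simp only: distrib_left mult.commute)
  then show ?thesis
    by simp
qed

lemma times_binomial_minus1: "n * (n - 1 choose k) = Suc k * (n choose Suc k)"
  using Suc_times_binomial_eq[of "n - 1" k] by (cases n) (simp_all add: mult.commute)

lemma sum_choose_lessThan: "(\<Sum>r<n. r choose k) = (n choose Suc k)"
  by (induction n) simp_all

lemma binom_span_zero: "(\<lambda>m. 0) \<in> binom_span K"
  using binom_span.base[of K K 0] by simp

lemma binom_span_scale: "\<phi> \<in> binom_span K \<Longrightarrow> (\<lambda>m. c * \<phi> m) \<in> binom_span K"
proof (induction rule: binom_span.induct)
  case (base k d)
  then show ?case
    using binom_span.base[of K k "c * d"] by (simp add: mult.assoc)
qed (auto simp: distrib_left intro: binom_span.add)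

lemma binom_span_sum:
  "(\<And>x. x \<in> X \<Longrightarrow> \<phi> x \<in> binom_span K) \<Longrightarrow> (\<lambda>m. \<Sum>x\<in>X. \<phi> x m) \<in> binom_span K"
  by (induction X rule: infinite_finite_induct) (auto intro: binom_span_zero binom_span.add)

lemma binom_span_coord: "\<phi> \<in> binom_span K \<Longrightarrow> (\<lambda>m. of_nat (m i) * \<phi> m) \<in> binom_span K"
proof (induction rule: binom_span.induct)
  case (base k c)
  have "of_nat (m i) * binom_prod k m =
      of_nat (k i) * binom_prod k m + of_nat (Suc (k i)) * binom_prod (k(i := Suc (k i))) m" for m
    unfolding binom_prod_update_left binom_prod_remove[of k m i]
    using arg_cong[OF times_binomial[of "m i" "k i"], of "of_nat :: nat \<Rightarrow> complex"]
    by (simp del: of_nat_Suc mult_Suc flip: mult.assoc distrib_right)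
  then have eq: "of_nat (m i) * (c * binom_prod k m) = c * of_nat (k i) * binom_prod k m +
      c * of_nat (Suc (k i)) * binom_prod (k(i := Suc (k i))) m" for m
    by (simp only: mult.left_commute[of _ c] distrib_left mult.assoc)
  have "K j \<le> (k(i := Suc (k i))) j" for j
    using base[of j] by auto
  then show ?case
    unfolding eq by (intro binom_span.add binom_span.base base)
qed (auto simp: distrib_left intro: binom_span.add)

lemma binom_span_poly_fun:
  "\<psi> \<in> poly_fun \<Longrightarrow> \<phi> \<in> binom_span K \<Longrightarrow> (\<lambda>m. \<psi> m * \<phi> m) \<in> binom_span K"
proof (induction arbitrary: \<phi> rule: poly_fun.induct)
  case (const c)
  then show ?case
    by (rule binom_span_scale)
next
  case (coord i)
  then show ?case
    by (rule binom_span_coord)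
next
  case (add \<psi> \<psi>')
  then show ?case
    unfolding distrib_right by (intro binom_span.add)
next
  case (mult \<psi> \<psi>')
  show ?case
    unfolding mult.assoc by (intro mult.IH mult.prems)
qed

text \<open>By absorption, the factor \<open>m i\<close> together with the shift to
  \<open>m i - 1\<close> raises the order by exactly one. At \<open>m i = 0\<close> both sides of
  the absorption identity vanish.\<close>

lemma binom_span_shift:
  "\<phi> \<in> binom_span K \<Longrightarrow>
    (\<lambda>m. of_nat (m i) * \<phi> (m(i := m i - 1))) \<in> binom_span (K(i := Suc (K i)))"
proof (induction rule: binom_span.induct)
  case (base k c)
  have "of_nat (m i) * binom_prod k (m(i := m i - 1)) =
      of_nat (Suc (k i)) * binom_prod (k(i := Suc (k i))) m" for m
    unfolding binom_prod_update_left binom_prod_update_right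
    using arg_cong[OF times_binomial_minus1[of "m i" "k i"], of "of_nat :: nat \<Rightarrow> complex"]
    by (simp del: of_nat_Suc mult_Suc flip: mult.assoc)
  then have eq: "of_nat (m i) * (c * binom_prod k (m(i := m i - 1))) =
      c * of_nat (Suc (k i)) * binom_prod (k(i := Suc (k i))) m" for m
    by (simp only: mult.left_commute[of _ c] mult.assoc)
  show ?case
    unfolding eq by (intro binom_span.base) (use base in auto)
qed (auto simp: distrib_left intro: binom_span.add)

text \<open>The hockey-stick identity: discrete summation raises the order by one.\<close>

lemma binom_span_sum_below:
  "\<phi> \<in> binom_span K \<Longrightarrow> (\<lambda>m. \<Sum>r<m i. \<phi> (m(i := r))) \<in> binom_span (K(i := Suc (K i)))"
proof (induction rule: binom_span.induct)
  case (base k c)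
  have eq: "(\<Sum>r<m i. c * binom_prod k (m(i := r))) = c * binom_prod (k(i := Suc (k i))) m" for m
    unfolding binom_prod_update_left binom_prod_update_right
    by (simp add: sum_choose_lessThan flip: sum_distrib_left sum_distrib_right of_nat_sum)
  show ?case
    unfolding eq by (intro binom_span.base) (use base in auto)
qed (auto simp: sum.distrib intro: binom_span.add)

lemma poly_fun_uminus: "\<phi> \<in> poly_fun \<Longrightarrow> (\<lambda>m. - \<phi> m) \<in> poly_fun"
  using poly_fun.mult[OF poly_fun.const[of "-1"], of \<phi>] by simp

lemma poly_fun_diff: "\<phi> \<in> poly_fun \<Longrightarrow> \<psi> \<in> poly_fun \<Longrightarrow> (\<lambda>m. \<phi> m - \<psi> m) \<in> poly_fun"
  using poly_fun.add[OF _ poly_fun_uminus, of \<phi> \<psi>] by simp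

lemma poly_fun_power: "\<phi> \<in> poly_fun \<Longrightarrow> (\<lambda>m. \<phi> m ^ n) \<in> poly_fun"
  by (induction n) (simp_all add: poly_fun.const poly_fun.mult)

lemma poly_fun_divide: "\<phi> \<in> poly_fun \<Longrightarrow> (\<lambda>m. \<phi> m / c) \<in> poly_fun"
  unfolding divide_inverse by (intro poly_fun.mult poly_fun.const)

lemma poly_fun_sum: "(\<And>x. x \<in> X \<Longrightarrow> \<phi> x \<in> poly_fun) \<Longrightarrow> (\<lambda>m. \<Sum>x\<in>X. \<phi> x m) \<in> poly_fun"
  by (induction X rule: infinite_finite_induct) (auto intro: poly_fun.intros)

lemmas poly_fun_intros = poly_fun.intros poly_fun_uminus poly_fun_diff poly_fun_power
  poly_fun_divide

section \<open>Families of power series, treated coefficient by coefficient\<close>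

definition poly_fps :: "(('i::finite \<Rightarrow> nat) \<Rightarrow> complex fps) \<Rightarrow> bool" where
  "poly_fps \<Psi> \<longleftrightarrow> (\<forall>n. (\<lambda>m. fps_nth (\<Psi> m) n) \<in> poly_fun)"

definition binom_fps :: "('i::finite \<Rightarrow> nat) \<Rightarrow> (('i \<Rightarrow> nat) \<Rightarrow> complex fps) \<Rightarrow> bool" where
  "binom_fps K \<Phi> \<longleftrightarrow> (\<forall>n. (\<lambda>m. fps_nth (\<Phi> m) n) \<in> binom_span K)"

lemma poly_fps_exp: "\<psi> \<in> poly_fun \<Longrightarrow> poly_fps (\<lambda>m. fps_exp (\<psi> m))"
  unfolding poly_fps_def fps_exp_nth by (intro allI poly_fun_divide poly_fun_power)

lemma poly_fps_mult: "poly_fps \<Psi> \<Longrightarrow> poly_fps \<Psi>' \<Longrightarrow> poly_fps (\<lambda>m. \<Psi> m * \<Psi>' m)"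
  unfolding poly_fps_def fps_mult_nth by (intro allI poly_fun_sum poly_fun.mult) auto

lemma binom_fps_mult: "poly_fps \<Psi> \<Longrightarrow> binom_fps K \<Phi> \<Longrightarrow> binom_fps K (\<lambda>m. \<Psi> m * \<Phi> m)"
  unfolding poly_fps_def binom_fps_def fps_mult_nth
  by (intro allI binom_span_sum binom_span_poly_fun) auto

lemma binom_fps_shift:
  "binom_fps K \<Phi> \<Longrightarrow>
    binom_fps (K(i := Suc (K i))) (\<lambda>m. fps_const (of_nat (m i)) * \<Phi> (m(i := m i - 1)))"
  unfolding binom_fps_def fps_mult_left_const_nth
  by (intro allI binom_span_shift[of "\<lambda>m. fps_nth (\<Phi> m) _"]) blast

lemma binom_fps_sum_below:
  "binom_fps K \<Phi> \<Longrightarrow> binom_fps (K(i := Suc (K i))) (\<lambda>m. \<Sum>r<m i. \<Phi> (m(i := r)))"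
  unfolding binom_fps_def fps_sum_nth by (auto intro: binom_span_sum_below[of "\<lambda>m. fps_nth (\<Phi> m) _"])

section \<open>The reordering coefficients\<close>

lemma UNIV_gen: "UNIV = {T41, T42, T31, T32}"
  using gen.exhaust by auto

instance gen :: finite
  by standard (simp add: UNIV_gen)

text \<open>
  The quotient \<open>(e\<^bsup>(1 - 2 s) h\<^esup> - e\<^sup>h) / s\<close>, continued to \<open>s = 0\<close>: its coefficients are polynomials in \<open>s\<close>. Splitting off
  the factor \<open>s\<close> is what raises the order in \<open>s\<close> at each reordering step.
\<close>

definition exp_diff_quotient :: "nat \<Rightarrow> complex fps" where
  "exp_diff_quotient s = fps_exp 1 *
     Abs_fps (\<lambda>n. if n = 0 then 0 else (-2) ^ n * of_nat s ^ (n - 1) / fact n)"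

lemma exp_diff_quotient:
  "fps_exp (1 - 2 * of_nat s) - fps_exp 1 = fps_const (of_nat s) * exp_diff_quotient s"
proof -
  have "fps_exp (- 2 * of_nat s) - 1 = fps_const (of_nat s) *
      Abs_fps (\<lambda>n. if n = 0 then 0 else (-2) ^ n * of_nat s ^ (n - 1) / fact n :: complex)"
  proof (rule fps_ext)
    show "fps_nth (fps_exp (- 2 * of_nat s) - 1) n = fps_nth (fps_const (of_nat s) *
      Abs_fps (\<lambda>n. if n = 0 then 0 else (-2) ^ n * of_nat s ^ (n - 1) / fact n :: complex)) n" for n
      unfolding fps_sub_nth fps_exp_nth fps_mult_left_const_nth fps_nth_Abs_fps power_mult_distrib
      by (cases n) (simp_all add: algebra_simps)
  qed
  then have "fps_exp 1 * (fps_exp (- 2 * of_nat s) - 1) =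
      fps_const (of_nat s) * exp_diff_quotient s"
    by (simp only: exp_diff_quotient_def mult.left_commute)
  then show ?thesis
    by (simp add: right_diff_distrib flip: fps_exp_add_mult)
qed

lemma poly_fps_exp_diff_quotient: "poly_fps (\<lambda>m. exp_diff_quotient (m i))"
proof -
  have "poly_fps (\<lambda>m. Abs_fps (\<lambda>n. if n = 0 then 0 else
      (-2) ^ n * of_nat (m i) ^ (n - 1) / fact n))"
    unfolding poly_fps_def fps_nth_Abs_fps
  proof
    show "(\<lambda>m. if n = 0 then 0 else (-2) ^ n * of_nat (m i) ^ (n - 1) / fact n) \<in> poly_fun" for n
      by (cases "n = 0") (auto intro!: poly_fun_intros)
  qed
  then show ?thesis
    unfolding exp_diff_quotient_def by (intro poly_fps_mult poly_fps_exp poly_fun.const)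
qed

text \<open>The second factor in the definition has zero constant term. Hence each reordering step
  contributes a factor h.\<close>

lemma fps_X_dvd_exp_diff_quotient: "fps_X dvd exp_diff_quotient s"
proof (cases "exp_diff_quotient s = 0")
  case False
  then have "1 \<le> subdegree (exp_diff_quotient s)"
    by (rule subdegree_geI) (simp add: exp_diff_quotient_def)
  with False show ?thesis
    by (simp add: fps_dvd_iff)
qed simp

text \<open>Unrolls the recursion in \<open>r\<close> into a sum. The factor \<open>s\<close> is
  kept next to the coefficient at \<open>s - 1\<close>, which is the shape that
  \<open>binom_fps_shift\<close> consumes, while the sum over \<open>r'\<close> suits
  \<open>binom_fps_sum_below\<close>.\<close>

lemma subst_exp_reorder_coeff_Suc:
  "subst_exp (reorder_coeff (Suc i) r s) = (\<Sum>r'<r. exp_diff_quotient s *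
     fps_exp (- 2 * (of_nat r' - of_nat i)) *
     (fps_const (of_nat s) * subst_exp (reorder_coeff i r' (s - 1))))"
proof (induction r)
  case 0
  show ?case
    by (simp add: additive.zero[OF additive_subst_exp])
next
  case (Suc r)
  have diff: "subst_exp (qpow (1 - 2 * int s) - qpow 1) = fps_const (of_nat s) * exp_diff_quotient s"
    by (simp add: additive.diff[OF additive_subst_exp] subst_exp_qpow exp_diff_quotient)
  have exp: "subst_exp (qpow (- 2 * (int r - int i))) = fps_exp (- 2 * (of_nat r - of_nat i))"
    by (simp add: subst_exp_qpow)
  show ?case
    unfolding reorder_coeff.simps additive.add[OF additive_subst_exp] subst_exp_mult diff exp Suc
      sum.lessThan_Suc
    by (simp only: mult_ac)
qed

lemma fps_X_power_dvd_reorder_coeff: "fps_X ^ i dvd subst_exp (reorder_coeff i r s)"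
proof (induction i arbitrary: r s)
  case (Suc i)
  have "fps_X * fps_X ^ i dvd exp_diff_quotient s * subst_exp (reorder_coeff i r' (s - 1))" for r'
    by (intro mult_dvd_mono fps_X_dvd_exp_diff_quotient Suc)
  then have "fps_X ^ Suc i dvd exp_diff_quotient s * subst_exp (reorder_coeff i r' (s - 1)) *
      (fps_exp (- 2 * (of_nat r' - of_nat i)) * fps_const (of_nat s))" for r'
    by (simp only: power_Suc dvd_mult2)
  then show ?case
    unfolding subst_exp_reorder_coeff_Suc by (intro dvd_sum) (simp only: mult_ac)
qed simp

text \<open>One reordering step raises both orders: the shift in \<open>S\<close> raises the order
  in \<open>S\<close>, and the summation over values below \<open>m R\<close> raises the order in
  \<open>R\<close>. The remaining exponential factors have polynomial coefficients and lower
  neither.\<close>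

lemma binom_fps_reorder_coeff:
  fixes R S :: "'i::finite"
  assumes "R \<noteq> S"
  shows "binom_fps (\<lambda>x. if x = R \<or> x = S then i else 0)
    (\<lambda>m. subst_exp (reorder_coeff i (m R) (m S)))"
proof (induction i)
  case 0
  have "(\<lambda>m :: 'i \<Rightarrow> nat. fps_nth 1 n) \<in> binom_span (\<lambda>x. 0)" for n
    using binom_span.base[of "\<lambda>x. 0" "\<lambda>x. 0" "fps_nth 1 n"] by (simp add: binom_prod_def)
  then show ?case
    by (simp only: binom_fps_def subst_exp_one reorder_coeff.simps if_cancel simp_thms)
next
  case (Suc i)
  let ?K = "\<lambda>x. if x = R \<or> x = S then i else 0"
  have factor: "poly_fps (\<lambda>m. exp_diff_quotient (m S) * fps_exp (- 2 * (of_nat (m R) - of_nat i)))"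
    by (intro poly_fps_mult poly_fps_exp_diff_quotient poly_fps_exp poly_fun_intros)
  have "binom_fps (?K(S := Suc (?K S)))
      (\<lambda>m. fps_const (of_nat (m S)) * subst_exp (reorder_coeff i (m R) (m S - 1)))"
    using binom_fps_shift[OF Suc, of S] assms by (simp only: fun_upd_same fun_upd_other simp_thms)
  note step = binom_fps_sum_below[OF binom_fps_mult[OF factor this], of R]
  have "(?K(S := Suc (?K S)))(R := Suc ((?K(S := Suc (?K S))) R)) =
      (\<lambda>x. if x = R \<or> x = S then Suc i else 0)"
    using assms by auto
  with step assms assms[symmetric] show ?case
    by (simp only: subst_exp_reorder_coeff_Suc fun_upd_same fun_upd_other simp_thms)
qed

lemma star_mono_coeff_in_binom_span:
  "(\<lambda>m. fps_nth (subst_exp (star_mono_coeff i m)) j) \<in>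
    binom_span (\<lambda>x. if x = Inl T32 \<or> x = Inr T41 then i else 0)"
proof -
  have "poly_fps (\<lambda>m. fps_exp (of_int (twist_exponent m i)))"
    unfolding twist_exponent_def of_int_diff of_int_mult of_int_minus of_int_add of_int_of_nat_eq
    by (intro poly_fps_exp poly_fun_intros)
  then have "binom_fps (\<lambda>x. if x = Inl T32 \<or> x = Inr T41 then i else 0)
      (\<lambda>m. subst_exp (star_mono_coeff i m))"
    unfolding star_mono_coeff_def subst_exp_mult subst_exp_qpow
    by (intro binom_fps_mult binom_fps_reorder_coeff) auto
  then show ?thesis
    by (simp add: binom_fps_def)
qed

lemma star_mono_coeff_low_order:
  assumes "j < i"
  shows "fps_nth (subst_exp (star_mono_coeff i m)) j = 0"
proof -
  have "fps_X ^ i dvd subst_exp (star_mono_coeff i m)"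
    unfolding star_mono_coeff_def subst_exp_mult by (intro dvd_mult fps_X_power_dvd_reorder_coeff)
  then obtain \<Phi> where "subst_exp (star_mono_coeff i m) = fps_X ^ i * \<Phi>"
    by (rule dvdE)
  then show ?thesis
    using assms by (simp add: fps_X_power_mult_nth)
qed

section \<open>Realisation by bidifferential operators\<close>

lemma additive_pderiv_var: "additive (pderiv_var i)"
  unfolding pderiv_var_def by (intro additive_sum_keys) (simp add: distrib_left single_add)

lemma pderiv_var_single:
  "pderiv_var i (Poly_Mapping.single m c) =
    Poly_Mapping.single (m - Poly_Mapping.single i 1) (of_nat (Poly_Mapping.lookup m i) * c)"
  unfolding pderiv_var_def by (rule sum_keys_single) simp

text \<open>The recursion for the falling factorial \<open>fact k * (n choose k)\<close>, valid also
  for \<open>n \<le> k\<close>, where both sides are zero.\<close>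

lemma fact_choose_Suc: "(n - k) * (fact k * (n choose k)) = fact (Suc k) * (n choose Suc k)"
proof -
  have "(n - k) * (n choose k) = Suc k * (n choose Suc k)"
    using binomial_absorb_comp[of n k] times_binomial_minus1[of n k] by simp
  then show ?thesis
    by (simp add: algebra_simps)
qed

lemma pderiv_var_power_single:
  "(pderiv_var i ^^ k) (Poly_Mapping.single m c) = Poly_Mapping.single (m - Poly_Mapping.single i k)
    (of_nat (fact k * (Poly_Mapping.lookup m i choose k)) * c)"
proof (induction k)
  case (Suc k)
  have "m - Poly_Mapping.single i k - Poly_Mapping.single i 1 = m - Poly_Mapping.single i (Suc k)"
    by (rule poly_mapping_eqI) (simp add: minus_poly_mapping.rep_eq lookup_single when_def)
  then show ?case
    using fact_choose_Suc[of "Poly_Mapping.lookup m i" k]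
    by (simp add: Suc pderiv_var_single minus_poly_mapping.rep_eq flip: of_nat_mult mult.assoc)
qed simp

definition fact_prod :: "(gen \<Rightarrow>\<^sub>0 nat) \<Rightarrow> nat" where
  "fact_prod \<alpha> = (\<Prod>i\<in>UNIV. fact (Poly_Mapping.lookup \<alpha> i))"

text \<open>The link between the two sides of the argument: up to a constant, an iterated derivative
  multiplies a monomial by a product of binomial coefficients. Where \<open>m - \<alpha>\<close>
  truncates, that product is zero.\<close>

lemma pderiv_multi_single:
  "pderiv_multi \<alpha> (Poly_Mapping.single m c) = Poly_Mapping.single (m - \<alpha>)
    (of_nat (fact_prod \<alpha>) * binom_prod (Poly_Mapping.lookup \<alpha>) (Poly_Mapping.lookup m) * c)"
proof -
  obtain a b c' d where \<alpha>: "\<alpha> = mon a b c' d"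
    by (rule mon_exhaust)
  obtain s t u v where m: "m = mon s t u v"
    by (rule mon_exhaust)
  have "Poly_Mapping.single T41 k = mon k 0 0 0" "Poly_Mapping.single T42 k = mon 0 k 0 0"
    "Poly_Mapping.single T31 k = mon 0 0 k 0" "Poly_Mapping.single T32 k = mon 0 0 0 k" for k
    by (simp_all add: mon_def)
  then show ?thesis
    by (simp add: \<alpha> m pderiv_multi_def pderiv_var_power_single mon_minus fact_prod_def binom_prod_def
        UNIV_gen mult_ac)
qed

lemma additive_pderiv_multi: "additive (pderiv_multi \<alpha>)"
  unfolding pderiv_multi_def
  by (intro additive_comp[OF additive_funpow[OF additive_pderiv_var]]
      additive_funpow[OF additive_pderiv_var])

lemma additive_bidifferential:
  assumes "bidifferential B"
  shows "additive (\<lambda>f. B f g)" "additive (B f)"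
  using assms by (auto simp: bidifferential_def additive_def additive.add[OF additive_pderiv_multi]
      distrib_left distrib_right sum.distrib split_beta)

lemma bidifferential_term: "bidifferential (\<lambda>f g. b * pderiv_multi \<alpha> f * pderiv_multi \<beta> g)"
  unfolding bidifferential_def by (intro exI[of _ "{(\<alpha>, \<beta>)}"] exI[of _ "\<lambda>_ _. b"]) simp

lemma bidifferential_zero: "bidifferential (\<lambda>f g. 0)"
  unfolding bidifferential_def by (intro exI[of _ "{}"]) simp

lemma bidifferential_add:
  assumes "bidifferential B" "bidifferential B'"
  shows "bidifferential (\<lambda>f g. B f g + B' f g)"
proof -
  obtain S b where S: "finite S"
    "\<And>f g. B f g = (\<Sum>(\<alpha>, \<beta>)\<in>S. b \<alpha> \<beta> * pderiv_multi \<alpha> f * pderiv_multi \<beta> g)"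
    using assms(1) unfolding bidifferential_def by blast
  obtain S' b' where S': "finite S'"
    "\<And>f g. B' f g = (\<Sum>(\<alpha>, \<beta>)\<in>S'. b' \<alpha> \<beta> * pderiv_multi \<alpha> f * pderiv_multi \<beta> g)"
    using assms(2) unfolding bidifferential_def by blast
  \<comment> \<open>Outside its index set a coefficient family may take any value, so it is cut off
    to zero before both are added over the union.\<close>
  define z where "z T c \<alpha> \<beta> = (if (\<alpha>, \<beta>) \<in> T then c \<alpha> \<beta> else 0)"
    for T and c :: "_ \<Rightarrow> _ \<Rightarrow> complex mpoly" and \<alpha> \<beta> :: "gen \<Rightarrow>\<^sub>0 nat"
  have extend: "(\<Sum>(\<alpha>, \<beta>)\<in>T. c \<alpha> \<beta> * pderiv_multi \<alpha> f * pderiv_multi \<beta> g) =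
      (\<Sum>(\<alpha>, \<beta>)\<in>S \<union> S'. z T c \<alpha> \<beta> * pderiv_multi \<alpha> f * pderiv_multi \<beta> g)"
    if "T \<subseteq> S \<union> S'" for T c f g
    using that S(1) S'(1) by (intro sum.mono_neutral_cong_left) (auto simp: z_def)
  have "B f g + B' f g = (\<Sum>(\<alpha>, \<beta>)\<in>S \<union> S'.
      (z S b \<alpha> \<beta> + z S' b' \<alpha> \<beta>) * pderiv_multi \<alpha> f * pderiv_multi \<beta> g)" for f g
    unfolding S(2) S'(2) extend[OF Un_upper1] extend[OF Un_upper2]
    by (simp add: split_beta distrib_right sum.distrib)
  then show ?thesis
    unfolding bidifferential_def using S(1) S'(1)
    by (intro exI[of _ "S \<union> S'"] exI[of _ "\<lambda>\<alpha> \<beta>. z S b \<alpha> \<beta> + z S' b' \<alpha> \<beta>"]) simp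
qed

lemma bidifferential_sum:
  "(\<And>x. x \<in> X \<Longrightarrow> bidifferential (B x)) \<Longrightarrow> bidifferential (\<lambda>f g. \<Sum>x\<in>X. B x f g)"
  by (induction X rule: infinite_finite_induct) (auto intro: bidifferential_zero bidifferential_add)

lemma binom_prod_eq_0: "m i < k i \<Longrightarrow> binom_prod k m = 0"
  by (simp add: binom_prod_remove[of k m i])

lemma binom_prod_case_sum:
  "binom_prod k (case_sum f g) = binom_prod (k \<circ> Inl) f * binom_prod (k \<circ> Inr) g"
  unfolding binom_prod_def UNIV_sum
  by (subst prod.union_disjoint) (auto simp: prod.reindex)

text \<open>A basis function \<open>binom_prod k\<close> is realised by differentiating
  \<open>f\<close> and \<open>g\<close> along the two halves of \<open>k\<close> and multiplying by
  one monomial. That monomial restores the removed exponents with \<open>i\<close> pairs t41 t32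
  exchanged for t42 t31; the bound on \<open>k\<close> guarantees enough t41 and t32 for the
  exchange.\<close>

lemma binom_span_bidifferential:
  assumes "\<phi> \<in> binom_span (\<lambda>x. if x = Inl T32 \<or> x = Inr T41 then i else 0)"
  shows "\<exists>B. bidifferential B \<and> (\<forall>m c m' d. B (Poly_Mapping.single m c) (Poly_Mapping.single m' d) =
    Poly_Mapping.single (star_mono i m m') (\<phi> (exponents m m') * (c * d)))"
  using assms
proof (induction rule: binom_span.induct)
  case (base k a)
  define \<alpha> where "\<alpha> = mon (k (Inl T41)) (k (Inl T42)) (k (Inl T31)) (k (Inl T32))"
  define \<beta> where "\<beta> = mon (k (Inr T41)) (k (Inr T42)) (k (Inr T31)) (k (Inr T32))"
  have lookup: "Poly_Mapping.lookup \<alpha> = k \<circ> Inl" "Poly_Mapping.lookup \<beta> = k \<circ> Inr"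
  proof -
    show "Poly_Mapping.lookup \<alpha> = k \<circ> Inl"
    proof
      show "Poly_Mapping.lookup \<alpha> x = (k \<circ> Inl) x" for x
        by (cases x) (simp_all add: \<alpha>_def)
    qed
    show "Poly_Mapping.lookup \<beta> = k \<circ> Inr"
    proof
      show "Poly_Mapping.lookup \<beta> x = (k \<circ> Inr) x" for x
        by (cases x) (simp_all add: \<beta>_def)
    qed
  qed
  let ?F = "of_nat (fact_prod \<alpha>) * of_nat (fact_prod \<beta>) :: complex"
  have F: "?F \<noteq> 0"
    by (simp add: fact_prod_def)
  \<comment> \<open>Dividing by \<open>?F\<close> cancels the factorials produced by the
    derivatives.\<close>
  let ?b = "Poly_Mapping.single (star_mono i \<alpha> \<beta>) (a / ?F)"
  have "?b * pderiv_multi \<alpha> (Poly_Mapping.single m c) * pderiv_multi \<beta> (Poly_Mapping.single m' d) =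
      Poly_Mapping.single (star_mono i m m') (a * binom_prod k (exponents m m') * (c * d))" for m c m' d
  \<comment> \<open>If the product vanishes, so do both sides. Otherwise \<open>k\<close> is bounded
    by the exponents, and no subtraction in the monomial identity truncates.\<close>
  proof (cases "binom_prod k (exponents m m') = 0")
    case True
    then show ?thesis
      by (auto simp: pderiv_multi_single lookup binom_prod_case_sum mult_single)
  next
    case False
    then have le: "k x \<le> exponents m m' x" for x
      using binom_prod_eq_0[of "exponents m m'" x k] by (meson not_le)
    have i: "i \<le> k (Inl T32)" "i \<le> k (Inr T41)"
      using base[of "Inl T32"] base[of "Inr T41"] by simp_all
    have "star_mono i \<alpha> \<beta> + (m - \<alpha>) + (m' - \<beta>) = star_mono i m m'"
      using i le[of "Inl T41"] le[of "Inl T42"] le[of "Inl T31"] le[of "Inl T32"]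
        le[of "Inr T41"] le[of "Inr T42"] le[of "Inr T31"] le[of "Inr T32"]
      by (intro mono_eqI)
        (simp_all add: star_mono_def lookup_add minus_poly_mapping.rep_eq \<alpha>_def \<beta>_def)
    moreover have "a / ?F * (of_nat (fact_prod \<alpha>) * x * c) * (of_nat (fact_prod \<beta>) * y * d) =
        a * (x * y) * (c * d)" for x y
      using F by (simp add: field_simps)
    ultimately show ?thesis
      by (simp only: pderiv_multi_single mult_single lookup binom_prod_case_sum)
  qed
  then show ?case
    using bidifferential_term[of ?b \<alpha> \<beta>] by (intro exI[of _ "\<lambda>f g. ?b * pderiv_multi \<alpha> f * pderiv_multi \<beta> g"]) simp
next
  case (add \<phi> \<psi>)
  then obtain B B' where "bidifferential B" "bidifferential B'"
    "\<And>m c m' d. B (Poly_Mapping.single m c) (Poly_Mapping.single m' d) =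
       Poly_Mapping.single (star_mono i m m') (\<phi> (exponents m m') * (c * d))"
    "\<And>m c m' d. B' (Poly_Mapping.single m c) (Poly_Mapping.single m' d) =
       Poly_Mapping.single (star_mono i m m') (\<psi> (exponents m m') * (c * d))"
    by blast
  then show ?case
    by (intro exI[of _ "\<lambda>f g. B f g + B' f g"])
      (simp add: bidifferential_add distrib_right single_add)
qed

text \<open>Makes the range of summation independent of \<open>m\<close>, as a single operator for
  all arguments requires. Terms with \<open>i\<close> above the exponent of \<open>T32\<close> have
  zero coefficient, and terms with \<open>i > j\<close> are of order at least \<open>i\<close> in
  h.\<close>

lemma star_coeff_single_truncated:
  "star_coeff j (Poly_Mapping.single m c) (Poly_Mapping.single m' d) =
    (\<Sum>i\<le>j. Poly_Mapping.single (star_mono i m m')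
      (fps_nth (subst_exp (star_mono_coeff i (exponents m m'))) j * (c * d)))"
proof -
  let ?r = "Poly_Mapping.lookup m T32"
  let ?t = "\<lambda>i. Poly_Mapping.single (star_mono i m m')
      (fps_nth (subst_exp (star_mono_coeff i (exponents m m'))) j * (c * d))"
  have "?t i = 0" if "?r < i" for i
    using that by (simp add: star_mono_coeff_def reorder_coeff_eq_0 additive.zero[OF additive_subst_exp])
  then have "(\<Sum>i\<le>?r. ?t i) = (\<Sum>i\<le>max ?r j. ?t i)"
    by (intro sum.mono_neutral_left) auto
  also have "\<dots> = (\<Sum>i\<le>j. ?t i)"
    by (intro sum.mono_neutral_right) (auto simp: star_mono_coeff_low_order)
  finally show ?thesis
    by (simp add: star_coeff_single)
qed

lemma star_coeff_0: "star_coeff 0 f g = f * g"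
proof (rule biadditive_eqI[of "star_coeff 0" "(*)"])
  show "star_coeff 0 (Poly_Mapping.single m c) (Poly_Mapping.single m' d) =
      Poly_Mapping.single m c * Poly_Mapping.single m' d" for m m' c d
  proof -
    have "star_mono 0 m m' = m + m'"
      by (simp add: star_mono_def)
    then show ?thesis
      by (simp add: star_coeff_single_truncated star_mono_coeff_def subst_exp_mult subst_exp_qpow
          subst_exp_one mult_single)
  qed
qed (intro additive_star_coeff_left additive_star_coeff_right additive_mult_const additive_const_mult)+

theorem theorem5p1:
  shows "(\<forall>f g. star_coeff 0 f g = f * g) \<and>
    (\<forall>j\<ge>1. \<exists>B. bidifferential B \<and> (\<forall>f g. star_coeff j f g = B f g))"
proof (intro conjI allI impI)
  show "star_coeff 0 f g = f * g" for f g
    by (rule star_coeff_0)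
  fix j :: nat
  assume "j \<ge> 1"
  \<comment> \<open>With \<open>j\<close> fixed, the coefficient of h^j is for each \<open>i\<close>
    a function of the exponents in the span of order at least \<open>i\<close>, hence realised by an
    operator.\<close>
  have "\<forall>i. \<exists>B. bidifferential B \<and>
      (\<forall>m c m' d. B (Poly_Mapping.single m c) (Poly_Mapping.single m' d) =
        Poly_Mapping.single (star_mono i m m')
          (fps_nth (subst_exp (star_mono_coeff i (exponents m m'))) j * (c * d)))"
    by (intro allI binom_span_bidifferential star_mono_coeff_in_binom_span)
  then obtain B where B: "\<And>i. bidifferential (B i)"
    "\<And>i m c m' d. B i (Poly_Mapping.single m c) (Poly_Mapping.single m' d) =
        Poly_Mapping.single (star_mono i m m')
          (fps_nth (subst_exp (star_mono_coeff i (exponents m m'))) j * (c * d))"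
    by metis
  define B' where "B' f g = (\<Sum>i\<le>j. B i f g)" for f g
  have bidiff: "bidifferential B'"
    unfolding B'_def[abs_def] by (intro bidifferential_sum B)
  have "star_coeff j f g = B' f g" for f g
    by (rule biadditive_eqI[of "star_coeff j" B', OF additive_star_coeff_left additive_star_coeff_right
          additive_bidifferential[OF bidiff]])
      (simp add: star_coeff_single_truncated B B'_def)
  with bidiff show "\<exists>B. bidifferential B \<and> (\<forall>f g. star_coeff j f g = B f g)"
    by blast
qed

end
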